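(* The Markov category $\mathsf{TLinRel}$ of total linear relations is equivalent to the Markov category $\mathsf{Copar}(\mathsf{Vec})$ of copartial maps in $\mathsf{Vec}$.
   Context: A Markov category is a symmetric monoidal category in which every object $X$ carries a commutative comonoid structure $\mathsf{copy}_X:X\to X\otimes X$, $\mathsf{del}_X:X\to I$, compatible with the tensor product, such that $\mathsf{del}$ is natural. Equivalence of Markov categories means an equivalence compatible with the symmetric monoidal structure and with $\mathsf{copy}$ and $\mathsf{del}$. $\mathsf{Vec}$ is the category of finite-dimensional vector spaces $\mathbb R^n$ ($n\ge0$) and linear maps. **$\mathsf{TLinRel}$:** objects are the spaces $\mathbb R^n$. Morphisms $X\to Y$ are linear relations, i.e. vector subspaces $\mathbb L\subseteq X\times Y$, which are total: for every $x\in X$ there is $y\in Y$ with $(x,y)\in\mathbb L$. Composition is relational composition $R;S=\{(x,z):\exists y,\ (x,y)\in R,\ (y,z)\in S\}$, and the identity is the diagonal. The tensor is the product on objects, with $R_1\otimes R_2=\{((x_1,x_2),(y_1,y_2)):(x_i,y_i)\in R_i\}$ and unit $\mathbb R^0$. Also $\mathsf{copy}_X=\{(x,(x,x))\}$ and $\mathsf{del}_X=\{(x,0)\}\subseteq X\times\mathbb R^0$. **$\mathsf{Copar}(\mathsf{Vec})$:** objects are the spaces $\mathbb R^n$. Morphisms $X\to Y$ (copartial maps) are cospans of linear maps $X\xrightarrow{f}P\xleftarrow{p}Y$ with $p$ surjective, up to isomorphism of the apex $P$ commuting with both legs. The identity is $X\xrightarrow{\mathsf{id}}X\xleftarrow{\mathsf{id}}X$,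 and composition is by pushout. The monoidal structure is given by the biproduct ($X\otimes Y=X\times Y$, acting componentwise on cospans) with unit $\mathbb R^0$. Copy and delete are the cospans $X\xrightarrow{\Delta}X\times X\xleftarrow{\mathsf{id}}X\times X$, where $\Delta$ is the diagonal, and $X\xrightarrow{!}\mathbb R^0\xleftarrow{\mathsf{id}}\mathbb R^0$. *)

theory Defs
  imports "Jordan_Normal_Form.Matrix" "HOL-Library.FuncSet"
begin

section \<open>Markov categories\<close>

text \<open>Composition is written in diagrammatic order throughout: \<open>f ;; g\<close> is first \<open>f\<close>, then \<open>g\<close>.
  Operations are only meaningful on the objects and (composable) arrows of the category.\<close>

record ('o, 'a) cat =
  Obj :: "'o set"
  Arr :: "'a set"
  Dom :: "'a \<Rightarrow> 'o"
  Cod :: "'a \<Rightarrow> 'o"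
  Ident :: "'o \<Rightarrow> 'a"
  Comp :: "'a \<Rightarrow> 'a \<Rightarrow> 'a"  (infixl ";;\<index>" 60)

definition Hom :: "('o, 'a, 'z) cat_scheme \<Rightarrow> 'o \<Rightarrow> 'o \<Rightarrow> 'a set" where
  "Hom C X Y = {f \<in> Arr C. Dom C f = X \<and> Cod C f = Y}"

definition inverse_arrows :: "('o, 'a, 'z) cat_scheme \<Rightarrow> 'a \<Rightarrow> 'a \<Rightarrow> bool" where
  "inverse_arrows C f g \<longleftrightarrow>
     f \<in> Arr C \<and> g \<in> Hom C (Cod C f) (Dom C f) \<and>
     Comp C f g = Ident C (Dom C f) \<and> Comp C g f = Ident C (Cod C f)"

definition is_iso :: "('o, 'a, 'z) cat_scheme \<Rightarrow> 'a \<Rightarrow> bool" where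
  "is_iso C f \<longleftrightarrow> (\<exists>g. inverse_arrows C f g)"

definition Inv :: "('o, 'a, 'z) cat_scheme \<Rightarrow> 'a \<Rightarrow> 'a" where
  "Inv C f = (THE g. inverse_arrows C f g)"

locale category =
  fixes C :: "('o, 'a, 'z) cat_scheme" (structure)
  assumes dom_cod_obj: "f \<in> Arr C \<Longrightarrow> Dom C f \<in> Obj C \<and> Cod C f \<in> Obj C"
    and ident_hom: "X \<in> Obj C \<Longrightarrow> Ident C X \<in> Hom C X X"
    and comp_hom: "\<lbrakk>f \<in> Hom C X Y; g \<in> Hom C Y Z\<rbrakk> \<Longrightarrow> f ;; g \<in> Hom C X Z"
    and comp_ident_left: "f \<in> Hom C X Y \<Longrightarrow> Ident C X ;; f = f"
    and comp_ident_right: "f \<in> Hom C X Y \<Longrightarrow> f ;; Ident C Y = f"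
    and comp_assoc: "\<lbrakk>f \<in> Hom C W X; g \<in> Hom C X Y; h \<in> Hom C Y Z\<rbrakk>
      \<Longrightarrow> (f ;; g) ;; h = f ;; (g ;; h)"

text \<open>The tensor product is \<open>\<boxdot>\<close> on objects and \<open>\<boxtimes>\<close> on arrows. The structure maps have the types
  \<open>Assoc X Y Z : (X \<boxdot> Y) \<boxdot> Z \<rightarrow> X \<boxdot> (Y \<boxdot> Z)\<close>, \<open>LUnit X : I \<boxdot> X \<rightarrow> X\<close>, \<open>RUnit X : X \<boxdot> I \<rightarrow> X\<close>,
  \<open>Swap X Y : X \<boxdot> Y \<rightarrow> Y \<boxdot> X\<close>, where \<open>I = UnitObj\<close>.\<close>

record ('o, 'a) smcat = "('o, 'a) cat" +
  TensObj :: "'o \<Rightarrow> 'o \<Rightarrow> 'o"  (infixl "\<boxdot>\<index>" 70)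
  TensArr :: "'a \<Rightarrow> 'a \<Rightarrow> 'a"  (infixl "\<boxtimes>\<index>" 70)
  UnitObj :: "'o"
  Assoc :: "'o \<Rightarrow> 'o \<Rightarrow> 'o \<Rightarrow> 'a"
  LUnit :: "'o \<Rightarrow> 'a"
  RUnit :: "'o \<Rightarrow> 'a"
  Swap :: "'o \<Rightarrow> 'o \<Rightarrow> 'a"

locale symmetric_monoidal_category = category C
  for C :: "('o, 'a, 'z) smcat_scheme" (structure) +
  assumes unit_obj: "UnitObj C \<in> Obj C"
    and tens_obj: "\<lbrakk>X \<in> Obj C; Y \<in> Obj C\<rbrakk> \<Longrightarrow> X \<boxdot> Y \<in> Obj C"
    and tens_hom: "\<lbrakk>f \<in> Hom C X Y; g \<in> Hom C X' Y'\<rbrakk> \<Longrightarrow> f \<boxtimes> g \<in> Hom C (X \<boxdot> X') (Y \<boxdot> Y')"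
    and tens_ident: "\<lbrakk>X \<in> Obj C; Y \<in> Obj C\<rbrakk> \<Longrightarrow> Ident C X \<boxtimes> Ident C Y = Ident C (X \<boxdot> Y)"
    and tens_comp: "\<lbrakk>f \<in> Hom C X Y; g \<in> Hom C Y Z; f' \<in> Hom C X' Y'; g' \<in> Hom C Y' Z'\<rbrakk>
      \<Longrightarrow> (f ;; g) \<boxtimes> (f' ;; g') = (f \<boxtimes> f') ;; (g \<boxtimes> g')"
    and assoc_hom: "\<lbrakk>X \<in> Obj C; Y \<in> Obj C; Z \<in> Obj C\<rbrakk>
      \<Longrightarrow> Assoc C X Y Z \<in> Hom C ((X \<boxdot> Y) \<boxdot> Z) (X \<boxdot> (Y \<boxdot> Z))"
    and assoc_iso: "\<lbrakk>X \<in> Obj C; Y \<in> Obj C; Z \<in> Obj C\<rbrakk> \<Longrightarrow> is_iso C (Assoc C X Y Z)"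
    and assoc_natural: "\<lbrakk>f \<in> Hom C X X'; g \<in> Hom C Y Y'; h \<in> Hom C Z Z'\<rbrakk>
      \<Longrightarrow> ((f \<boxtimes> g) \<boxtimes> h) ;; Assoc C X' Y' Z' = Assoc C X Y Z ;; (f \<boxtimes> (g \<boxtimes> h))"
    and lunit_hom: "X \<in> Obj C \<Longrightarrow> LUnit C X \<in> Hom C (UnitObj C \<boxdot> X) X"
    and lunit_iso: "X \<in> Obj C \<Longrightarrow> is_iso C (LUnit C X)"
    and lunit_natural: "f \<in> Hom C X Y \<Longrightarrow> (Ident C (UnitObj C) \<boxtimes> f) ;; LUnit C Y = LUnit C X ;; f"
    and runit_hom: "X \<in> Obj C \<Longrightarrow> RUnit C X \<in> Hom C (X \<boxdot> UnitObj C) X"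
    and runit_iso: "X \<in> Obj C \<Longrightarrow> is_iso C (RUnit C X)"
    and runit_natural: "f \<in> Hom C X Y \<Longrightarrow> (f \<boxtimes> Ident C (UnitObj C)) ;; RUnit C Y = RUnit C X ;; f"
    and pentagon: "\<lbrakk>W \<in> Obj C; X \<in> Obj C; Y \<in> Obj C; Z \<in> Obj C\<rbrakk>
      \<Longrightarrow> Assoc C (W \<boxdot> X) Y Z ;; Assoc C W X (Y \<boxdot> Z)
        = (Assoc C W X Y \<boxtimes> Ident C Z) ;; Assoc C W (X \<boxdot> Y) Z ;; (Ident C W \<boxtimes> Assoc C X Y Z)"
    and triangle: "\<lbrakk>X \<in> Obj C; Y \<in> Obj C\<rbrakk>
      \<Longrightarrow> Assoc C X (UnitObj C) Y ;; (Ident C X \<boxtimes> LUnit C Y) = RUnit C X \<boxtimes> Ident C Y"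
    and swap_hom: "\<lbrakk>X \<in> Obj C; Y \<in> Obj C\<rbrakk> \<Longrightarrow> Swap C X Y \<in> Hom C (X \<boxdot> Y) (Y \<boxdot> X)"
    and swap_swap: "\<lbrakk>X \<in> Obj C; Y \<in> Obj C\<rbrakk> \<Longrightarrow> Swap C X Y ;; Swap C Y X = Ident C (X \<boxdot> Y)"
    and swap_natural: "\<lbrakk>f \<in> Hom C X X'; g \<in> Hom C Y Y'\<rbrakk>
      \<Longrightarrow> (f \<boxtimes> g) ;; Swap C X' Y' = Swap C X Y ;; (g \<boxtimes> f)"
    and hexagon: "\<lbrakk>X \<in> Obj C; Y \<in> Obj C; Z \<in> Obj C\<rbrakk>
      \<Longrightarrow> Assoc C X Y Z ;; Swap C X (Y \<boxdot> Z) ;; Assoc C Y Z X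
        = (Swap C X Y \<boxtimes> Ident C Z) ;; Assoc C Y X Z ;; (Ident C Y \<boxtimes> Swap C X Z)"

record ('o, 'a) mcat = "('o, 'a) smcat" +
  Copy :: "'o \<Rightarrow> 'a"
  Del :: "'o \<Rightarrow> 'a"

text \<open>The canonical isomorphism \<open>(X \<boxdot> X) \<boxdot> (Y \<boxdot> Y) \<rightarrow> (X \<boxdot> Y) \<boxdot> (X \<boxdot> Y)\<close> exchanging the two
  middle factors.\<close>

definition middle_swap :: "('o, 'a, 'z) smcat_scheme \<Rightarrow> 'o \<Rightarrow> 'o \<Rightarrow> 'a" where
  "middle_swap C X Y =
     Assoc C X X (Y \<boxdot>\<^bsub>C\<^esub> Y)
     ;;\<^bsub>C\<^esub> (Ident C X \<boxtimes>\<^bsub>C\<^esub> Inv C (Assoc C X Y Y))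
     ;;\<^bsub>C\<^esub> (Ident C X \<boxtimes>\<^bsub>C\<^esub> (Swap C X Y \<boxtimes>\<^bsub>C\<^esub> Ident C Y))
     ;;\<^bsub>C\<^esub> (Ident C X \<boxtimes>\<^bsub>C\<^esub> Assoc C Y X Y)
     ;;\<^bsub>C\<^esub> Inv C (Assoc C X Y (X \<boxdot>\<^bsub>C\<^esub> Y))"

locale markov_category = symmetric_monoidal_category C
  for C :: "('o, 'a, 'z) mcat_scheme" (structure) +
  assumes copy_hom: "X \<in> Obj C \<Longrightarrow> Copy C X \<in> Hom C X (X \<boxdot> X)"
    and del_hom: "X \<in> Obj C \<Longrightarrow> Del C X \<in> Hom C X (UnitObj C)"
    and copy_coassoc: "X \<in> Obj C
      \<Longrightarrow> Copy C X ;; (Copy C X \<boxtimes> Ident C X) ;; Assoc C X X X = Copy C X ;; (Ident C X \<boxtimes> Copy C X)"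
    and copy_counit_left: "X \<in> Obj C
      \<Longrightarrow> Copy C X ;; (Del C X \<boxtimes> Ident C X) ;; LUnit C X = Ident C X"
    and copy_counit_right: "X \<in> Obj C
      \<Longrightarrow> Copy C X ;; (Ident C X \<boxtimes> Del C X) ;; RUnit C X = Ident C X"
    and copy_commutative: "X \<in> Obj C \<Longrightarrow> Copy C X ;; Swap C X X = Copy C X"
    and copy_tens: "\<lbrakk>X \<in> Obj C; Y \<in> Obj C\<rbrakk>
      \<Longrightarrow> Copy C (X \<boxdot> Y) = (Copy C X \<boxtimes> Copy C Y) ;; middle_swap C X Y"
    and del_tens: "\<lbrakk>X \<in> Obj C; Y \<in> Obj C\<rbrakk>
      \<Longrightarrow> Del C (X \<boxdot> Y) = (Del C X \<boxtimes> Del C Y) ;; LUnit C (UnitObj C)"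
    and copy_unit: "Copy C (UnitObj C) ;; LUnit C (UnitObj C) = Ident C (UnitObj C)"
    and del_unit: "Del C (UnitObj C) = Ident C (UnitObj C)"
    and del_natural: "f \<in> Hom C X Y \<Longrightarrow> f ;; Del C Y = Del C X"


section \<open>Equivalence of Markov categories\<close>

text \<open>A strong monoidal functor \<open>F\<close> carries coherence isomorphisms
  \<open>FMul F X Y : F X \<boxdot> F Y \<rightarrow> F (X \<boxdot> Y)\<close> and \<open>FUnit F : I \<rightarrow> F I\<close>.\<close>

record ('o, 'a, 'p, 'b) mfunctor =
  FObj :: "'o \<Rightarrow> 'p"
  FArr :: "'a \<Rightarrow> 'b"
  FMul :: "'o \<Rightarrow> 'o \<Rightarrow> 'b"
  FUnit :: "'b"

locale markov_functor = C: markov_category C + D: markov_category D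
  for C :: "('o, 'a, 'y) mcat_scheme" (structure)
    and D :: "('p, 'b, 'z) mcat_scheme" (structure) +
  fixes F :: "('o, 'a, 'p, 'b) mfunctor"
  assumes fobj: "X \<in> Obj C \<Longrightarrow> FObj F X \<in> Obj D"
    and farr_hom: "f \<in> Hom C X Y \<Longrightarrow> FArr F f \<in> Hom D (FObj F X) (FObj F Y)"
    and farr_ident: "X \<in> Obj C \<Longrightarrow> FArr F (Ident C X) = Ident D (FObj F X)"
    and farr_comp: "\<lbrakk>f \<in> Hom C X Y; g \<in> Hom C Y Z\<rbrakk>
      \<Longrightarrow> FArr F (f ;;\<^bsub>C\<^esub> g) = FArr F f ;;\<^bsub>D\<^esub> FArr F g"
    and fmul_hom: "\<lbrakk>X \<in> Obj C; Y \<in> Obj C\<rbrakk>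
      \<Longrightarrow> FMul F X Y \<in> Hom D (FObj F X \<boxdot>\<^bsub>D\<^esub> FObj F Y) (FObj F (X \<boxdot>\<^bsub>C\<^esub> Y))"
    and fmul_iso: "\<lbrakk>X \<in> Obj C; Y \<in> Obj C\<rbrakk> \<Longrightarrow> is_iso D (FMul F X Y)"
    and fmul_natural: "\<lbrakk>f \<in> Hom C X X'; g \<in> Hom C Y Y'\<rbrakk>
      \<Longrightarrow> (FArr F f \<boxtimes>\<^bsub>D\<^esub> FArr F g) ;;\<^bsub>D\<^esub> FMul F X' Y' = FMul F X Y ;;\<^bsub>D\<^esub> FArr F (f \<boxtimes>\<^bsub>C\<^esub> g)"
    and funit_hom: "FUnit F \<in> Hom D (UnitObj D) (FObj F (UnitObj C))"
    and funit_iso: "is_iso D (FUnit F)"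
    and fmul_assoc: "\<lbrakk>X \<in> Obj C; Y \<in> Obj C; Z \<in> Obj C\<rbrakk>
      \<Longrightarrow> (FMul F X Y \<boxtimes>\<^bsub>D\<^esub> Ident D (FObj F Z)) ;;\<^bsub>D\<^esub> FMul F (X \<boxdot>\<^bsub>C\<^esub> Y) Z ;;\<^bsub>D\<^esub> FArr F (Assoc C X Y Z)
        = Assoc D (FObj F X) (FObj F Y) (FObj F Z)
          ;;\<^bsub>D\<^esub> (Ident D (FObj F X) \<boxtimes>\<^bsub>D\<^esub> FMul F Y Z) ;;\<^bsub>D\<^esub> FMul F X (Y \<boxdot>\<^bsub>C\<^esub> Z)"
    and fmul_lunit: "X \<in> Obj C
      \<Longrightarrow> (FUnit F \<boxtimes>\<^bsub>D\<^esub> Ident D (FObj F X)) ;;\<^bsub>D\<^esub> FMul F (UnitObj C) X ;;\<^bsub>D\<^esub> FArr F (LUnit C X)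
        = LUnit D (FObj F X)"
    and fmul_runit: "X \<in> Obj C
      \<Longrightarrow> (Ident D (FObj F X) \<boxtimes>\<^bsub>D\<^esub> FUnit F) ;;\<^bsub>D\<^esub> FMul F X (UnitObj C) ;;\<^bsub>D\<^esub> FArr F (RUnit C X)
        = RUnit D (FObj F X)"
    and fmul_swap: "\<lbrakk>X \<in> Obj C; Y \<in> Obj C\<rbrakk>
      \<Longrightarrow> FMul F X Y ;;\<^bsub>D\<^esub> FArr F (Swap C X Y) = Swap D (FObj F X) (FObj F Y) ;;\<^bsub>D\<^esub> FMul F Y X"
    and farr_copy: "X \<in> Obj C \<Longrightarrow> FArr F (Copy C X) = Copy D (FObj F X) ;;\<^bsub>D\<^esub> FMul F X X"
    and farr_del: "X \<in> Obj C \<Longrightarrow> FArr F (Del C X) = Del D (FObj F X) ;;\<^bsub>D\<^esub> FUnit F"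

definition id_functor :: "('o, 'a, 'z) mcat_scheme \<Rightarrow> ('o, 'a, 'o, 'a) mfunctor" where
  "id_functor C =
     \<lparr>FObj = (\<lambda>X. X), FArr = (\<lambda>f. f), FMul = (\<lambda>X Y. Ident C (X \<boxdot>\<^bsub>C\<^esub> Y)), FUnit = Ident C (UnitObj C)\<rparr>"

definition comp_functor ::
  "('q, 'c, 'z) mcat_scheme \<Rightarrow> ('o, 'a, 'p, 'b) mfunctor \<Rightarrow> ('p, 'b, 'q, 'c) mfunctor
    \<Rightarrow> ('o, 'a, 'q, 'c) mfunctor" where
  "comp_functor E F G =
     \<lparr>FObj = (\<lambda>X. FObj G (FObj F X)),
      FArr = (\<lambda>f. FArr G (FArr F f)),
      FMul = (\<lambda>X Y. FMul G (FObj F X) (FObj F Y) ;;\<^bsub>E\<^esub> FArr G (FMul F X Y)),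
      FUnit = FUnit G ;;\<^bsub>E\<^esub> FArr G (FUnit F)\<rparr>"

text \<open>Monoidal natural isomorphisms between \<open>F, G : C \<rightarrow> D\<close> whose components are comonoid
  homomorphisms. The latter is not automatic for \<open>Copy\<close>: isomorphisms in a Markov category need not
  be deterministic.\<close>

definition markov_nat_iso ::
  "('o, 'a, 'y) mcat_scheme \<Rightarrow> ('p, 'b, 'z) mcat_scheme
    \<Rightarrow> ('o, 'a, 'p, 'b) mfunctor \<Rightarrow> ('o, 'a, 'p, 'b) mfunctor \<Rightarrow> ('o \<Rightarrow> 'b) \<Rightarrow> bool" where
  "markov_nat_iso C D F G \<eta> \<longleftrightarrow>
     (\<forall>X\<in>Obj C. \<eta> X \<in> Hom D (FObj F X) (FObj G X) \<and> is_iso D (\<eta> X)) \<and>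
     (\<forall>X\<in>Obj C. \<forall>Y\<in>Obj C. \<forall>f\<in>Hom C X Y. FArr F f ;;\<^bsub>D\<^esub> \<eta> Y = \<eta> X ;;\<^bsub>D\<^esub> FArr G f) \<and>
     (\<forall>X\<in>Obj C. \<forall>Y\<in>Obj C. FMul F X Y ;;\<^bsub>D\<^esub> \<eta> (X \<boxdot>\<^bsub>C\<^esub> Y) = (\<eta> X \<boxtimes>\<^bsub>D\<^esub> \<eta> Y) ;;\<^bsub>D\<^esub> FMul G X Y) \<and>
     FUnit F ;;\<^bsub>D\<^esub> \<eta> (UnitObj C) = FUnit G \<and>
     (\<forall>X\<in>Obj C. \<eta> X ;;\<^bsub>D\<^esub> Copy D (FObj G X) = Copy D (FObj F X) ;;\<^bsub>D\<^esub> (\<eta> X \<boxtimes>\<^bsub>D\<^esub> \<eta> X)) \<and>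
     (\<forall>X\<in>Obj C. \<eta> X ;;\<^bsub>D\<^esub> Del D (FObj G X) = Del D (FObj F X))"

definition markov_equivalent ::
  "('o, 'a, 'y) mcat_scheme \<Rightarrow> ('p, 'b, 'z) mcat_scheme \<Rightarrow> bool" where
  "markov_equivalent C D \<longleftrightarrow>
     (\<exists>F G \<eta> \<epsilon>. markov_functor C D F \<and> markov_functor D C G \<and>
        markov_nat_iso C C (id_functor C) (comp_functor C F G) \<eta> \<and>
        markov_nat_iso D D (comp_functor D G F) (id_functor D) \<epsilon>)"


section \<open>Total linear relations\<close>

text \<open>The object \<open>n :: nat\<close> stands for \<open>\<real>\<^sup>n\<close>, i.e. \<open>carrier_vec n :: real vec set\<close>, and
  \<open>\<real>\<^sup>n \<times> \<real>\<^sup>m\<close> is identified with \<open>\<real>\<^sup>n\<^sup>+\<^sup>m\<close> by concatenation \<open>x @\<^sub>v y\<close>. Arrows are triples of domain,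
  codomain and relation.\<close>

definition linear_relation :: "nat \<Rightarrow> nat \<Rightarrow> (real vec \<times> real vec) set \<Rightarrow> bool" where
  "linear_relation n m L \<longleftrightarrow>
     L \<subseteq> carrier_vec n \<times> carrier_vec m \<and>
     (0\<^sub>v n, 0\<^sub>v m) \<in> L \<and>
     (\<forall>x y x' y'. (x, y) \<in> L \<longrightarrow> (x', y') \<in> L \<longrightarrow> (x + x', y + y') \<in> L) \<and>
     (\<forall>a x y. (x, y) \<in> L \<longrightarrow> (a \<cdot>\<^sub>v x, a \<cdot>\<^sub>v y) \<in> L)"

definition total_relation :: "nat \<Rightarrow> (real vec \<times> real vec) set \<Rightarrow> bool" where
  "total_relation n L \<longleftrightarrow> (\<forall>x\<in>carrier_vec n. \<exists>y. (x, y) \<in> L)"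

type_synonym rel_arrow = "nat \<times> nat \<times> (real vec \<times> real vec) set"

definition TLinRel :: "(nat, rel_arrow) mcat" where
  "TLinRel =
     \<lparr>Obj = UNIV,
      Arr = {(n, m, L). linear_relation n m L \<and> total_relation n L},
      Dom = (\<lambda>(n, m, L). n),
      Cod = (\<lambda>(n, m, L). m),
      Ident = (\<lambda>n. (n, n, Id_on (carrier_vec n))),
      Comp = (\<lambda>(n, m, R) (m', l, S). (n, l, R O S)),
      TensObj = (+),
      TensArr = (\<lambda>(n1, m1, R1) (n2, m2, R2).
        (n1 + n2, m1 + m2,
         {(x1 @\<^sub>v x2, y1 @\<^sub>v y2) | x1 x2 y1 y2. (x1, y1) \<in> R1 \<and> (x2, y2) \<in> R2})),
      UnitObj = 0,
      Assoc = (\<lambda>n m l. ((n + m) + l, n + (m + l),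
        {((x @\<^sub>v y) @\<^sub>v z, x @\<^sub>v (y @\<^sub>v z)) | x y z.
           x \<in> carrier_vec n \<and> y \<in> carrier_vec m \<and> z \<in> carrier_vec l})),
      LUnit = (\<lambda>n. (0 + n, n, {(0\<^sub>v 0 @\<^sub>v x, x) | x. x \<in> carrier_vec n})),
      RUnit = (\<lambda>n. (n + 0, n, {(x @\<^sub>v 0\<^sub>v 0, x) | x. x \<in> carrier_vec n})),
      Swap = (\<lambda>n m. (n + m, m + n,
        {(x @\<^sub>v y, y @\<^sub>v x) | x y. x \<in> carrier_vec n \<and> y \<in> carrier_vec m})),
      Copy = (\<lambda>n. (n, n + n, {(x, x @\<^sub>v x) | x. x \<in> carrier_vec n})),
      Del = (\<lambda>n. (n, 0, {(x, 0\<^sub>v 0) | x. x \<in> carrier_vec n}))\<rparr>"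


section \<open>Vector spaces and linear maps\<close>

text \<open>Arrows are triples of domain, codomain and underlying map, the latter being \<open>undefined\<close> outside
  its domain so that equality of arrows is equality of maps.\<close>

type_synonym lin_arrow = "nat \<times> nat \<times> (real vec \<Rightarrow> real vec)"

definition linear_map_on :: "nat \<Rightarrow> nat \<Rightarrow> (real vec \<Rightarrow> real vec) \<Rightarrow> bool" where
  "linear_map_on n m f \<longleftrightarrow>
     f \<in> carrier_vec n \<rightarrow>\<^sub>E carrier_vec m \<and>
     (\<forall>x\<in>carrier_vec n. \<forall>y\<in>carrier_vec n. f (x + y) = f x + f y) \<and>
     (\<forall>a. \<forall>x\<in>carrier_vec n. f (a \<cdot>\<^sub>v x) = a \<cdot>\<^sub>v f x)"

definition Vec :: "(nat, lin_arrow) cat" where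
  "Vec =
     \<lparr>Obj = UNIV,
      Arr = {(n, m, f). linear_map_on n m f},
      Dom = (\<lambda>(n, m, f). n),
      Cod = (\<lambda>(n, m, f). m),
      Ident = (\<lambda>n. (n, n, \<lambda>x\<in>carrier_vec n. x)),
      Comp = (\<lambda>(n, m, f) (m', l, g). (n, l, compose (carrier_vec n) g f))\<rparr>"

definition surjective_arrow :: "lin_arrow \<Rightarrow> bool" where
  "surjective_arrow = (\<lambda>(n, m, f). f ` carrier_vec n = carrier_vec m)"

text \<open>\<open>f \<oplus> g\<close>, acting componentwise on the two blocks of a vector.\<close>

definition vec_sum :: "lin_arrow \<Rightarrow> lin_arrow \<Rightarrow> lin_arrow" where
  "vec_sum = (\<lambda>(n1, m1, f) (n2, m2, g).
     (n1 + n2, m1 + m2,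
      \<lambda>x\<in>carrier_vec (n1 + n2). f (vec_first x n1) @\<^sub>v g (vec_last x n2)))"

definition vec_swap :: "nat \<Rightarrow> nat \<Rightarrow> lin_arrow" where
  "vec_swap n m = (n + m, m + n, \<lambda>x\<in>carrier_vec (n + m). vec_last x m @\<^sub>v vec_first x n)"

definition vec_diag :: "nat \<Rightarrow> lin_arrow" where
  "vec_diag n = (n, n + n, \<lambda>x\<in>carrier_vec n. x @\<^sub>v x)"

definition vec_bang :: "nat \<Rightarrow> lin_arrow" where
  "vec_bang n = (n, 0, \<lambda>x\<in>carrier_vec n. 0\<^sub>v 0)"

text \<open>\<open>P --i--> R <--j-- Q\<close> is a pushout of the span \<open>P <--p-- Y --g--> Q\<close>.\<close>

definition is_pushout :: "('o, 'a, 'z) cat_scheme \<Rightarrow> 'a \<Rightarrow> 'a \<Rightarrow> 'a \<Rightarrow> 'a \<Rightarrow> bool" where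
  "is_pushout C p g i j \<longleftrightarrow>
     p \<in> Arr C \<and> g \<in> Arr C \<and> Dom C p = Dom C g \<and>
     i \<in> Hom C (Cod C p) (Cod C i) \<and> j \<in> Hom C (Cod C g) (Cod C i) \<and>
     p ;;\<^bsub>C\<^esub> i = g ;;\<^bsub>C\<^esub> j \<and>
     (\<forall>T\<in>Obj C. \<forall>i'\<in>Hom C (Cod C p) T. \<forall>j'\<in>Hom C (Cod C g) T.
        p ;;\<^bsub>C\<^esub> i' = g ;;\<^bsub>C\<^esub> j' \<longrightarrow>
        (\<exists>!u. u \<in> Hom C (Cod C i) T \<and> i ;;\<^bsub>C\<^esub> u = i' \<and> j ;;\<^bsub>C\<^esub> u = j'))"


section \<open>Copartial maps\<close>

text \<open>The pair \<open>(f, p)\<close> is the cospan \<open>X --f--> P <--p-- Y\<close> with apex \<open>P = Cod Vec f = Cod Vec p\<close>.\<close>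

definition cospans :: "nat \<Rightarrow> nat \<Rightarrow> (lin_arrow \<times> lin_arrow) set" where
  "cospans X Y = {(f, p). \<exists>P\<in>Obj Vec. f \<in> Hom Vec X P \<and> p \<in> Hom Vec Y P \<and> surjective_arrow p}"

definition cospan_iso :: "nat \<Rightarrow> nat \<Rightarrow> ((lin_arrow \<times> lin_arrow) \<times> (lin_arrow \<times> lin_arrow)) set" where
  "cospan_iso X Y = {((f, p), (f', p')).
     (f, p) \<in> cospans X Y \<and> (f', p') \<in> cospans X Y \<and>
     (\<exists>h\<in>Hom Vec (Cod Vec f) (Cod Vec f'). is_iso Vec h \<and> f ;;\<^bsub>Vec\<^esub> h = f' \<and> p ;;\<^bsub>Vec\<^esub> h = p')}"

abbreviation cospan_class :: "nat \<Rightarrow> nat \<Rightarrow> lin_arrow \<times> lin_arrow \<Rightarrow> (lin_arrow \<times> lin_arrow) set" where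
  "cospan_class X Y c \<equiv> cospan_iso X Y `` {c}"

type_synonym copar_arrow = "nat \<times> nat \<times> (lin_arrow \<times> lin_arrow) set"

text \<open>Composition and tensor are the liftings to isomorphism classes, written as a union over all
  representatives; composition also ranges over all choices of pushout.\<close>

definition copar_comp :: "copar_arrow \<Rightarrow> copar_arrow \<Rightarrow> copar_arrow" where
  "copar_comp = (\<lambda>(X, Y, c) (Y', Z, d).
     (X, Z, \<Union>{cospan_class X Z (f ;;\<^bsub>Vec\<^esub> i, q ;;\<^bsub>Vec\<^esub> j) | f p g q i j.
                (f, p) \<in> c \<and> (g, q) \<in> d \<and> is_pushout Vec p g i j}))"

definition copar_tens :: "copar_arrow \<Rightarrow> copar_arrow \<Rightarrow> copar_arrow" where
  "copar_tens = (\<lambda>(X1, Y1, c1) (X2, Y2, c2).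
     (X1 + X2, Y1 + Y2,
      \<Union>{cospan_class (X1 + X2) (Y1 + Y2) (vec_sum f1 f2, vec_sum p1 p2) | f1 p1 f2 p2.
          (f1, p1) \<in> c1 \<and> (f2, p2) \<in> c2}))"

text \<open>The class of \<open>X --f--> Y <--id-- Y\<close>.\<close>

definition copar_of :: "lin_arrow \<Rightarrow> copar_arrow" where
  "copar_of f = (Dom Vec f, Cod Vec f,
     cospan_class (Dom Vec f) (Cod Vec f) (f, Ident Vec (Cod Vec f)))"

text \<open>The associator and unitors of the biproduct are identities because concatenation of vectors
  is strictly associative and unital.\<close>

definition CoparVec :: "(nat, copar_arrow) mcat" where
  "CoparVec =
     \<lparr>Obj = UNIV,
      Arr = {(X, Y, c). c \<in> cospans X Y // cospan_iso X Y},
      Dom = (\<lambda>(X, Y, c). X),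
      Cod = (\<lambda>(X, Y, c). Y),
      Ident = (\<lambda>X. copar_of (Ident Vec X)),
      Comp = copar_comp,
      TensObj = (+),
      TensArr = copar_tens,
      UnitObj = 0,
      Assoc = (\<lambda>X Y Z. copar_of (Ident Vec (X + Y + Z))),
      LUnit = (\<lambda>X. copar_of (Ident Vec X)),
      RUnit = (\<lambda>X. copar_of (Ident Vec X)),
      Swap = (\<lambda>X Y. copar_of (vec_swap X Y)),
      Copy = (\<lambda>X. copar_of (vec_diag X)),
      Del = (\<lambda>X. copar_of (vec_bang X))\<rparr>"

end

theory Submission
  imports Defs
begin

text \<open>A cospan \<open>X --f--> P <--p-- Y\<close> with \<open>p\<close> surjective determines the total linear relation
  \<open>{(x, y). f x = p y}\<close>. Two cospans are isomorphic iff they determine the same relation, because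
  that relation contains the kernel of \<open>p\<close>; every total linear relation \<open>L\<close> arises, with
  \<open>P = Y / {y. (0, y) \<in> L}\<close>. In a pushout \<open>i, j\<close> of a surjection \<open>p\<close> and a map \<open>g\<close>, the points
  \<open>i a\<close> and \<open>j b\<close> agree iff \<open>a = p y\<close> and \<open>b = g y\<close> for some \<open>y\<close>, so composition of cospans becomes
  composition of relations. This correspondence is the identity on objects and respects all
  operations strictly, so the Markov axioms need only be checked for relations, where the
  associators and unitors are identities.\<close>

section \<open>Transport along strict isomorphisms\<close>

text \<open>The apex of a cospan must literally be some \<open>carrier_vec k\<close>, so the
  quotient of the codomain by the vectors related to zero has to be realised as a surjection onto a
  coordinate space with prescribed kernel. This construction, and the factorization of a linear map
  through a surjection whose kernel it kills, carry all the linear algebra. Pushouts come from the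
  same source: for \<open>p\<close> onto, the pairs \<open>(p y, g y)\<close> form a total linear
  relation, and a cospan representing it is a pushout of \<open>p\<close> and \<open>g\<close>.
  Composition of cospans is given only by a universal property, as a union over all representatives
  and all pushouts. Constructing one pushout is therefore not enough: every pushout must be shown to
  have the same description by points, which is done by comparing it with the constructed one. The
  constructed one is still needed, because the union over an empty family would be empty.
  Surjectivity of the backward leg corresponds to totality: it provides, for each \<open>x\<close>,
  some \<open>y\<close> with \<open>f x = p y\<close>.\<close>

context category
begin

lemma arr_hom: "f \<in> Arr C \<Longrightarrow> f \<in> Hom C (Dom C f) (Cod C f)"
  by (simp add: Hom_def)

lemma ident_arr: "X \<in> Obj C \<Longrightarrow> Ident C X \<in> Arr C \<and> Dom C (Ident C X) = X \<and> Cod C (Ident C X) = X"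
  using ident_hom by (simp add: Hom_def)

lemma comp_arr:
  assumes "f \<in> Arr C" "g \<in> Arr C" "Cod C f = Dom C g"
  shows "f ;; g \<in> Arr C \<and> Dom C (f ;; g) = Dom C f \<and> Cod C (f ;; g) = Cod C g"
  using comp_hom[of f "Dom C f" "Cod C f" g "Cod C g"] assms by (simp add: Hom_def)

lemma inverse_arrows_unique:
  assumes "inverse_arrows C f g" "inverse_arrows C f h"
  shows "g = h"
proof -
  have f: "f \<in> Hom C (Dom C f) (Cod C f)" and g: "g \<in> Hom C (Cod C f) (Dom C f)"
    and h: "h \<in> Hom C (Cod C f) (Dom C f)"
    using assms by (auto simp: inverse_arrows_def Hom_def)
  have "g = g ;; (f ;; h)"
    using assms comp_ident_right[OF g] by (simp add: inverse_arrows_def)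
  also have "\<dots> = (g ;; f) ;; h"
    using comp_assoc[OF g f h] by simp
  also have "\<dots> = h"
    using assms comp_ident_left[OF h] by (simp add: inverse_arrows_def)
  finally show ?thesis .
qed

lemma Inv_eqI: "inverse_arrows C f g \<Longrightarrow> Inv C f = g"
  unfolding Inv_def using inverse_arrows_unique by blast

lemma ident_inverse: "X \<in> Obj C \<Longrightarrow> inverse_arrows C (Ident C X) (Ident C X)"
  using ident_hom[of X] comp_ident_left[of "Ident C X" X X]
  by (auto simp: inverse_arrows_def Hom_def)

lemma Inv_ident: "X \<in> Obj C \<Longrightarrow> Inv C (Ident C X) = Ident C X"
  by (rule Inv_eqI[OF ident_inverse])

lemma is_iso_ident: "X \<in> Obj C \<Longrightarrow> is_iso C (Ident C X)"
  unfolding is_iso_def using ident_inverse by blast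

end

text \<open>Typing by \<open>Arr\<close>, \<open>Dom\<close> and \<open>Cod\<close> instead of
  \<open>Hom\<close> lets rewriting discharge composability conditions, since the intermediate
  objects of a composite are then computed and need not be guessed.\<close>

lemma (in markov_category) typing:
  "X \<in> Obj C \<Longrightarrow> Ident C X \<in> Arr C \<and> Dom C (Ident C X) = X \<and> Cod C (Ident C X) = X"
  "\<lbrakk>f \<in> Arr C; g \<in> Arr C; Cod C f = Dom C g\<rbrakk>
    \<Longrightarrow> f ;; g \<in> Arr C \<and> Dom C (f ;; g) = Dom C f \<and> Cod C (f ;; g) = Cod C g"
  "\<lbrakk>f \<in> Arr C; g \<in> Arr C\<rbrakk> \<Longrightarrow> f \<boxtimes> g \<in> Arr C \<and>
    Dom C (f \<boxtimes> g) = Dom C f \<boxdot> Dom C g \<and> Cod C (f \<boxtimes> g) = Cod C f \<boxdot> Cod C g"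
  "UnitObj C \<in> Obj C"
  "\<lbrakk>X \<in> Obj C; Y \<in> Obj C\<rbrakk> \<Longrightarrow> X \<boxdot> Y \<in> Obj C"
  "\<lbrakk>X \<in> Obj C; Y \<in> Obj C; Z \<in> Obj C\<rbrakk> \<Longrightarrow> Assoc C X Y Z \<in> Arr C \<and>
    Dom C (Assoc C X Y Z) = (X \<boxdot> Y) \<boxdot> Z \<and> Cod C (Assoc C X Y Z) = X \<boxdot> (Y \<boxdot> Z)"
  "X \<in> Obj C \<Longrightarrow> LUnit C X \<in> Arr C \<and> Dom C (LUnit C X) = UnitObj C \<boxdot> X \<and> Cod C (LUnit C X) = X"
  "X \<in> Obj C \<Longrightarrow> RUnit C X \<in> Arr C \<and> Dom C (RUnit C X) = X \<boxdot> UnitObj C \<and> Cod C (RUnit C X) = X"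
  "\<lbrakk>X \<in> Obj C; Y \<in> Obj C\<rbrakk> \<Longrightarrow> Swap C X Y \<in> Arr C \<and>
    Dom C (Swap C X Y) = X \<boxdot> Y \<and> Cod C (Swap C X Y) = Y \<boxdot> X"
  "X \<in> Obj C \<Longrightarrow> Copy C X \<in> Arr C \<and> Dom C (Copy C X) = X \<and> Cod C (Copy C X) = X \<boxdot> X"
  "X \<in> Obj C \<Longrightarrow> Del C X \<in> Arr C \<and> Dom C (Del C X) = X \<and> Cod C (Del C X) = UnitObj C"
  using ident_arr comp_arr tens_hom[OF arr_hom arr_hom, of f g] unit_obj tens_obj
    assoc_hom lunit_hom runit_hom swap_hom copy_hom del_hom
  by (simp_all add: Hom_def)

text \<open>No category axioms are assumed on either side, so the same list of equations serves both
  to derive the axioms of \<open>D\<close> from those of \<open>C\<close> and, later, to describe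
  the inverse map. The equations are oriented so that rewriting collects each expression of
  \<open>D\<close> into a single \<open>\<phi>\<close> applied to an expression of
  \<open>C\<close>.\<close>

locale strict_markov_map =
  fixes C :: "('o, 'a) mcat" and D :: "('o, 'b) mcat" and \<phi> :: "'a \<Rightarrow> 'b"
  assumes obj: "Obj D = Obj C"
    and arr: "f \<in> Arr C \<Longrightarrow> \<phi> f \<in> Arr D"
    and dom: "f \<in> Arr C \<Longrightarrow> Dom D (\<phi> f) = Dom C f"
    and cod: "f \<in> Arr C \<Longrightarrow> Cod D (\<phi> f) = Cod C f"
    and ident: "X \<in> Obj C \<Longrightarrow> Ident D X = \<phi> (Ident C X)"
    and comp: "\<lbrakk>f \<in> Arr C; g \<in> Arr C; Cod C f = Dom C g\<rbrakk>
      \<Longrightarrow> Comp D (\<phi> f) (\<phi> g) = \<phi> (Comp C f g)"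
    and tens_obj: "TensObj D = TensObj C"
    and tens_arr: "\<lbrakk>f \<in> Arr C; g \<in> Arr C\<rbrakk> \<Longrightarrow> TensArr D (\<phi> f) (\<phi> g) = \<phi> (TensArr C f g)"
    and unit_obj: "UnitObj D = UnitObj C"
    and assoc: "\<lbrakk>X \<in> Obj C; Y \<in> Obj C; Z \<in> Obj C\<rbrakk> \<Longrightarrow> Assoc D X Y Z = \<phi> (Assoc C X Y Z)"
    and lunit: "X \<in> Obj C \<Longrightarrow> LUnit D X = \<phi> (LUnit C X)"
    and runit: "X \<in> Obj C \<Longrightarrow> RUnit D X = \<phi> (RUnit C X)"
    and swap: "\<lbrakk>X \<in> Obj C; Y \<in> Obj C\<rbrakk> \<Longrightarrow> Swap D X Y = \<phi> (Swap C X Y)"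
    and copy: "X \<in> Obj C \<Longrightarrow> Copy D X = \<phi> (Copy C X)"
    and del: "X \<in> Obj C \<Longrightarrow> Del D X = \<phi> (Del C X)"

locale strict_markov_functor = strict_markov_map C D \<phi> + C: markov_category C + D: markov_category D
  for C :: "('o, 'a) mcat" and D :: "('o, 'b) mcat" and \<phi>
begin

text \<open>Tensor and unit agree on objects, so identities have the right type as coherence maps.
  Each coherence law then collapses to preservation of one structure map.\<close>

definition "strict_functor =
  \<lparr>FObj = (\<lambda>X. X), FArr = \<phi>, FMul = (\<lambda>X Y. Ident D (TensObj D X Y)), FUnit = Ident D (UnitObj D)\<rparr>"

lemma hom: "f \<in> Hom C X Y \<Longrightarrow> \<phi> f \<in> Hom D X Y"
  by (simp add: Hom_def arr dom cod)

lemma comp_eq: "\<lbrakk>f \<in> Hom C X Y; g \<in> Hom C Y Z\<rbrakk> \<Longrightarrow> \<phi> (Comp C f g) = Comp D (\<phi> f) (\<phi> g)"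
  by (rule comp[symmetric]) (auto simp: Hom_def)

lemma tens_eq: "\<lbrakk>f \<in> Hom C X Y; g \<in> Hom C X' Y'\<rbrakk> \<Longrightarrow> \<phi> (TensArr C f g) = TensArr D (\<phi> f) (\<phi> g)"
  by (rule tens_arr[symmetric]) (auto simp: Hom_def)

lemma markov_functor: "markov_functor C D strict_functor"
proof unfold_locales
  note objs = C.unit_obj C.tens_obj D.unit_obj D.tens_obj
  note simps = strict_functor_def obj tens_obj unit_obj objs D.tens_ident
    D.comp_ident_left D.comp_ident_right
  show "X \<in> Obj C \<Longrightarrow> FObj strict_functor X \<in> Obj D" for X
    by (simp add: simps)
  show "f \<in> Hom C X Y \<Longrightarrow>
      FArr strict_functor f \<in> Hom D (FObj strict_functor X) (FObj strict_functor Y)" for f X Y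
    by (simp add: simps hom)
  show "X \<in> Obj C \<Longrightarrow> FArr strict_functor (Ident C X) = Ident D (FObj strict_functor X)" for X
    by (simp add: simps ident)
  show "\<lbrakk>f \<in> Hom C X Y; g \<in> Hom C Y Z\<rbrakk>
      \<Longrightarrow> FArr strict_functor (Comp C f g) =
          Comp D (FArr strict_functor f) (FArr strict_functor g)" for f g X Y Z
    by (simp add: simps comp_eq)
  show "\<lbrakk>X \<in> Obj C; Y \<in> Obj C\<rbrakk>
      \<Longrightarrow> FMul strict_functor X Y \<in> Hom D
          (TensObj D (FObj strict_functor X) (FObj strict_functor Y))
          (FObj strict_functor (TensObj C X Y))" for X Y
    using D.ident_hom[of "TensObj C X Y"] by (simp add: simps)
  show "\<lbrakk>X \<in> Obj C; Y \<in> Obj C\<rbrakk> \<Longrightarrow> is_iso D (FMul strict_functor X Y)" for X Y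
    using D.is_iso_ident[of "TensObj C X Y"] by (simp add: simps)
  show "Comp D (TensArr D (FArr strict_functor f) (FArr strict_functor g))
      (FMul strict_functor X' Y') =
        Comp D (FMul strict_functor X Y) (FArr strict_functor (TensArr C f g))"
    if "f \<in> Hom C X X'" "g \<in> Hom C Y Y'" for f g X X' Y Y'
    using hom[OF C.tens_hom[OF that]] that
    by (simp add: simps tens_eq D.comp_ident_left D.comp_ident_right)
  show "FUnit strict_functor \<in> Hom D (UnitObj D) (FObj strict_functor (UnitObj C))"
    using D.ident_hom[of "UnitObj D"] by (simp add: simps)
  show "is_iso D (FUnit strict_functor)"
    using D.is_iso_ident[of "UnitObj D"] by (simp add: simps)
  show "Comp D (Comp D (TensArr D (FMul strict_functor X Y) (Ident D (FObj strict_functor Z)))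
      (FMul strict_functor (TensObj C X Y) Z))
          (FArr strict_functor (Assoc C X Y Z)) =
        Comp D (Comp D (Assoc D (FObj strict_functor X) (FObj strict_functor Y)
            (FObj strict_functor Z))
          (TensArr D (Ident D (FObj strict_functor X)) (FMul strict_functor Y Z)))
              (FMul strict_functor X (TensObj C Y Z))"
    if "X \<in> Obj C" "Y \<in> Obj C" "Z \<in> Obj C" for X Y Z
    using that hom[OF C.assoc_hom[OF that]] D.ident_hom[of "TensObj C (TensObj C X Y) Z"]
      D.ident_hom[of "TensObj C X (TensObj C Y Z)"]
    by (simp add: simps assoc[OF that])
  show "Comp D (Comp D (TensArr D (FUnit strict_functor) (Ident D (FObj strict_functor X)))
      (FMul strict_functor (UnitObj C) X))
          (FArr strict_functor (LUnit C X)) = LUnit D (FObj strict_functor X)" if "X \<in> Obj C" for X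
    using that hom[OF C.lunit_hom[OF that]] D.ident_hom[of "TensObj C (UnitObj C) X"]
    by (simp add: simps lunit)
  show "Comp D (Comp D (TensArr D (Ident D (FObj strict_functor X)) (FUnit strict_functor))
      (FMul strict_functor X (UnitObj C)))
          (FArr strict_functor (RUnit C X)) = RUnit D (FObj strict_functor X)" if "X \<in> Obj C" for X
    using that hom[OF C.runit_hom[OF that]] D.ident_hom[of "TensObj C X (UnitObj C)"]
    by (simp add: simps runit)
  show "Comp D (FMul strict_functor X Y) (FArr strict_functor (Swap C X Y)) =
        Comp D (Swap D (FObj strict_functor X) (FObj strict_functor Y)) (FMul strict_functor Y X)"
    if "X \<in> Obj C" "Y \<in> Obj C" for X Y
    using that hom[OF C.swap_hom[OF that]] by (simp add: simps swap)
  show "FArr strict_functor (Copy C X) =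
      Comp D (Copy D (FObj strict_functor X)) (FMul strict_functor X X)"
    if "X \<in> Obj C" for X
    using that hom[OF C.copy_hom[OF that]] by (simp add: simps copy)
  show "FArr strict_functor (Del C X) =
      Comp D (Del D (FObj strict_functor X)) (FUnit strict_functor)"
    if "X \<in> Obj C" for X
    using that hom[OF C.del_hom[OF that]] by (simp add: simps del)
qed

end

section \<open>Transfer of the Markov axioms along a bijection on arrows\<close>

locale strict_markov_iso = strict_markov_map C D \<phi> + C: markov_category C
  for C :: "('o, 'a) mcat" and D :: "('o, 'b) mcat" and \<phi> +
  assumes bij: "bij_betw \<phi> (Arr C) (Arr D)"
begin

lemma arrE: assumes "f \<in> Arr D" obtains f' where "f' \<in> Arr C" "f = \<phi> f'"
  using bij assms by (auto simp: bij_betw_def)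

lemma phi_hom: "f \<in> Arr C \<Longrightarrow> \<phi> f \<in> Hom D X Y \<longleftrightarrow> f \<in> Hom C X Y"
  by (auto simp: Hom_def arr dom cod)

text \<open>Surjectivity of \<open>\<phi>\<close> enters the axioms here: each arrow of
  \<open>D\<close> is replaced by a preimage with the same endpoints, after which an axiom of
  \<open>D\<close> is \<open>\<phi>\<close> applied to the same axiom of \<open>C\<close>.\<close>

lemma homE:
  assumes "f \<in> Hom D X Y"
  obtains f' where "f = \<phi> f'" "f' \<in> Arr C" "Dom C f' = X" "Cod C f' = Y"
proof -
  from assms have "f \<in> Arr D" by (simp add: Hom_def)
  then obtain f' where "f' \<in> Arr C" "f = \<phi> f'" by (rule arrE)
  with assms that show ?thesis by (auto simp: Hom_def dom cod)
qed

lemma inverse: assumes "inverse_arrows C f g" shows "inverse_arrows D (\<phi> f) (\<phi> g)"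
  using assms C.dom_cod_obj by (simp add: inverse_arrows_def Hom_def arr dom cod comp ident)

lemma iso: "is_iso C f \<Longrightarrow> is_iso D (\<phi> f)"
  using inverse by (auto simp: is_iso_def)

lemma category_D: "category D"
proof unfold_locales
  show "Dom D f \<in> Obj D \<and> Cod D f \<in> Obj D" if "f \<in> Arr D" for f
    using arrE[OF that] C.dom_cod_obj dom cod obj by metis
  show "Ident D X \<in> Hom D X X" if "X \<in> Obj D" for X
    using that by (simp add: C.typing obj ident arr dom cod Hom_def)
  show "Comp D f g \<in> Hom D X Z" if f: "f \<in> Hom D X Y" "g \<in> Hom D Y Z" for f g X Y Z
  proof -
    obtain f' g' where "f = \<phi> f'" "f' \<in> Arr C" "Dom C f' = X" "Cod C f' = Y"
      "g = \<phi> g'" "g' \<in> Arr C" "Dom C g' = Y" "Cod C g' = Z"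
      using f by (elim homE)
    then show ?thesis
      by (simp add: C.typing comp arr dom cod Hom_def)
  qed
  show "Comp D (Ident D X) f = f" if f: "f \<in> Hom D X Y" for f X Y
  proof -
    obtain f' where "f = \<phi> f'" "f' \<in> Arr C" "Dom C f' = X" "Cod C f' = Y"
      using f by (elim homE)
    then show ?thesis
      using C.comp_ident_left[OF C.arr_hom, of f'] C.dom_cod_obj[of f']
      by (simp add: C.typing comp ident)
  qed
  show "Comp D f (Ident D Y) = f" if f: "f \<in> Hom D X Y" for f X Y
  proof -
    obtain f' where "f = \<phi> f'" "f' \<in> Arr C" "Dom C f' = X" "Cod C f' = Y"
      using f by (elim homE)
    then show ?thesis
      using C.comp_ident_right[OF C.arr_hom, of f'] C.dom_cod_obj[of f']
      by (simp add: C.typing comp ident)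
  qed
  show "Comp D (Comp D f g) h = Comp D f (Comp D g h)"
    if f: "f \<in> Hom D W X" "g \<in> Hom D X Y" "h \<in> Hom D Y Z" for f g h W X Y Z
  proof -
    obtain f' g' h' where "f = \<phi> f'" "f' \<in> Arr C" "Dom C f' = W" "Cod C f' = X"
      "g = \<phi> g'" "g' \<in> Arr C" "Dom C g' = X" "Cod C g' = Y"
      "h = \<phi> h'" "h' \<in> Arr C" "Dom C h' = Y" "Cod C h' = Z"
      using f by (elim homE)
    then show ?thesis
      using C.comp_assoc[of f' W X g' Y h' Z] by (simp add: C.typing comp Hom_def)
  qed
qed

text \<open>\<open>Inv\<close> is a definite description, so evaluating it in \<open>D\<close>
  relies on uniqueness of inverses there. This is why the category laws of \<open>D\<close> have to
  be available first.\<close>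

lemma Inv_phi: assumes "is_iso C f" shows "Inv D (\<phi> f) = \<phi> (Inv C f)" "inverse_arrows C f (Inv C f)"
proof -
  interpret D: category D by (rule category_D)
  obtain g where "inverse_arrows C f g"
    using assms by (auto simp: is_iso_def)
  then show "Inv D (\<phi> f) = \<phi> (Inv C f)" "inverse_arrows C f (Inv C f)"
    using C.Inv_eqI D.Inv_eqI inverse by metis+
qed

lemma symmetric_monoidal_category_D: "symmetric_monoidal_category D"
proof -
  interpret D: category D by (rule category_D)
  note preserved = obj tens_obj unit_obj ident comp tens_arr assoc lunit runit swap
  show ?thesis
  proof unfold_locales
    show "UnitObj D \<in> Obj D"
      by (simp add: preserved C.unit_obj)
    show "TensObj D X Y \<in> Obj D" if "X \<in> Obj D" "Y \<in> Obj D" for X Y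
      using that by (simp add: preserved C.tens_obj)
    show "TensArr D f g \<in> Hom D (TensObj D X X') (TensObj D Y Y')"
      if "f \<in> Hom D X Y" "g \<in> Hom D X' Y'" for f g X X' Y Y'
      using that by (elim homE) (simp add: C.typing preserved arr dom cod Hom_def)
    show "TensArr D (Ident D X) (Ident D Y) = Ident D (TensObj D X Y)"
      if "X \<in> Obj D" "Y \<in> Obj D" for X Y
      using that by (simp add: C.typing preserved C.tens_ident)
    show "TensArr D (Comp D f g) (Comp D f' g') = Comp D (TensArr D f f') (TensArr D g g')"
      if fg: "f \<in> Hom D X Y" "g \<in> Hom D Y Z" "f' \<in> Hom D X' Y'" "g' \<in> Hom D Y' Z'"
      for f g f' g' X Y Z X' Y' Z'
    proof -
      obtain a b c d where abcd: "f = \<phi> a" "a \<in> Arr C" "Dom C a = X" "Cod C a = Y"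
        "g = \<phi> b" "b \<in> Arr C" "Dom C b = Y" "Cod C b = Z"
        "f' = \<phi> c" "c \<in> Arr C" "Dom C c = X'" "Cod C c = Y'"
        "g' = \<phi> d" "d \<in> Arr C" "Dom C d = Y'" "Cod C d = Z'"
        using fg by (elim homE)
      have "TensArr C (Comp C a b) (Comp C c d) = Comp C (TensArr C a c) (TensArr C b d)"
        using abcd by (intro C.tens_comp) (auto simp: Hom_def)
      with abcd show ?thesis by (simp add: C.typing preserved)
    qed
    show "Assoc D X Y Z \<in> Hom D (TensObj D (TensObj D X Y) Z) (TensObj D X (TensObj D Y Z))"
      if "X \<in> Obj D" "Y \<in> Obj D" "Z \<in> Obj D" for X Y Z
      using that by (simp add: preserved phi_hom C.typing C.assoc_hom)
    show "is_iso D (Assoc D X Y Z)" if "X \<in> Obj D" "Y \<in> Obj D" "Z \<in> Obj D" for X Y Z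
      using that by (simp add: preserved C.assoc_iso iso)
    show "Comp D (TensArr D (TensArr D f g) h) (Assoc D X' Y' Z') =
        Comp D (Assoc D X Y Z) (TensArr D f (TensArr D g h))"
      if fgh: "f \<in> Hom D X X'" "g \<in> Hom D Y Y'" "h \<in> Hom D Z Z'" for f g h X Y Z X' Y' Z'
    proof -
      obtain a b c where abc: "f = \<phi> a" "a \<in> Arr C" "Dom C a = X" "Cod C a = X'"
        "g = \<phi> b" "b \<in> Arr C" "Dom C b = Y" "Cod C b = Y'"
        "h = \<phi> c" "c \<in> Arr C" "Dom C c = Z" "Cod C c = Z'"
        using fgh by (elim homE)
      have "Comp C (TensArr C (TensArr C a b) c) (Assoc C X' Y' Z') =
          Comp C (Assoc C X Y Z) (TensArr C a (TensArr C b c))"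
        using abc by (intro C.assoc_natural) (auto simp: Hom_def)
      moreover have "X \<in> Obj C" "Y \<in> Obj C" "Z \<in> Obj C" "X' \<in> Obj C" "Y' \<in> Obj C" "Z' \<in> Obj C"
        using abc C.dom_cod_obj by blast+
      ultimately show ?thesis using abc by (simp add: C.typing preserved)
    qed
    show "LUnit D X \<in> Hom D (TensObj D (UnitObj D) X) X" if "X \<in> Obj D" for X
      using that by (simp add: preserved phi_hom C.typing C.lunit_hom)
    show "RUnit D X \<in> Hom D (TensObj D X (UnitObj D)) X" if "X \<in> Obj D" for X
      using that by (simp add: preserved phi_hom C.typing C.runit_hom)
    show "is_iso D (LUnit D X)" "is_iso D (RUnit D X)" if "X \<in> Obj D" for X
      using that by (simp_all add: preserved iso C.lunit_iso C.runit_iso)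
    show "Comp D (TensArr D (Ident D (UnitObj D)) f) (LUnit D Y) = Comp D (LUnit D X) f"
      "Comp D (TensArr D f (Ident D (UnitObj D))) (RUnit D Y) = Comp D (RUnit D X) f"
      if f: "f \<in> Hom D X Y" for f X Y
    proof -
      obtain a where a: "f = \<phi> a" "a \<in> Arr C" "Dom C a = X" "Cod C a = Y"
        using f by (elim homE)
      then have "a \<in> Hom C X Y" "X \<in> Obj C" "Y \<in> Obj C"
        using C.dom_cod_obj by (auto simp: Hom_def)
      with a C.lunit_natural[of a X Y] C.runit_natural[of a X Y] C.unit_obj
      show "Comp D (TensArr D (Ident D (UnitObj D)) f) (LUnit D Y) = Comp D (LUnit D X) f"
        "Comp D (TensArr D f (Ident D (UnitObj D))) (RUnit D Y) = Comp D (RUnit D X) f"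
        by (simp_all add: C.typing preserved)
    qed
    show "Comp D (Assoc D (TensObj D W X) Y Z) (Assoc D W X (TensObj D Y Z)) =
        Comp D (Comp D (TensArr D (Assoc D W X Y) (Ident D Z)) (Assoc D W (TensObj D X Y) Z))
          (TensArr D (Ident D W) (Assoc D X Y Z))"
      if "W \<in> Obj D" "X \<in> Obj D" "Y \<in> Obj D" "Z \<in> Obj D" for W X Y Z
      using that by (simp add: C.typing preserved C.pentagon)
    show "Comp D (Assoc D X (UnitObj D) Y) (TensArr D (Ident D X) (LUnit D Y)) =
        TensArr D (RUnit D X) (Ident D Y)" if "X \<in> Obj D" "Y \<in> Obj D" for X Y
      using that by (simp add: C.typing preserved C.triangle)
    show "Swap D X Y \<in> Hom D (TensObj D X Y) (TensObj D Y X)"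
      if "X \<in> Obj D" "Y \<in> Obj D" for X Y
      using that by (simp add: preserved phi_hom C.typing C.swap_hom)
    show "Comp D (Swap D X Y) (Swap D Y X) = Ident D (TensObj D X Y)"
      if "X \<in> Obj D" "Y \<in> Obj D" for X Y
      using that by (simp add: C.typing preserved C.swap_swap)
    show "Comp D (TensArr D f g) (Swap D X' Y') = Comp D (Swap D X Y) (TensArr D g f)"
      if fg: "f \<in> Hom D X X'" "g \<in> Hom D Y Y'" for f g X Y X' Y'
    proof -
      obtain a b where ab: "f = \<phi> a" "a \<in> Arr C" "Dom C a = X" "Cod C a = X'"
        "g = \<phi> b" "b \<in> Arr C" "Dom C b = Y" "Cod C b = Y'"
        using fg by (elim homE)
      have "Comp C (TensArr C a b) (Swap C X' Y') = Comp C (Swap C X Y) (TensArr C b a)"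
        using ab by (intro C.swap_natural) (auto simp: Hom_def)
      moreover have "X \<in> Obj C" "Y \<in> Obj C" "X' \<in> Obj C" "Y' \<in> Obj C"
        using ab C.dom_cod_obj by blast+
      ultimately show ?thesis using ab by (simp add: C.typing preserved)
    qed
    show "Comp D (Comp D (Assoc D X Y Z) (Swap D X (TensObj D Y Z))) (Assoc D Y Z X) =
        Comp D (Comp D (TensArr D (Swap D X Y) (Ident D Z)) (Assoc D Y X Z))
          (TensArr D (Ident D Y) (Swap D X Z))"
      if "X \<in> Obj D" "Y \<in> Obj D" "Z \<in> Obj D" for X Y Z
      using that by (simp add: C.typing preserved C.hexagon)
  qed
qed

text \<open>The axiom for copying a tensor product involves inverse associators through
  \<open>middle_swap\<close>, so its preservation goes through \<open>Inv_phi\<close>. The arrow and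
  domain facts supply the composability condition when \<open>middle_swap\<close> follows the two
  copy maps.\<close>

lemma middle_swap:
  assumes X: "X \<in> Obj C" and Y: "Y \<in> Obj C"
  shows "middle_swap D X Y = \<phi> (middle_swap C X Y)"
    and "middle_swap C X Y \<in> Arr C"
    and "Dom C (middle_swap C X Y) = TensObj C (TensObj C X X) (TensObj C Y Y)"
proof -
  note inv = C.assoc_iso[THEN Inv_phi(1)] C.assoc_iso[THEN Inv_phi(2)]
  have inv_typing: "Inv C (Assoc C U V W) \<in> Arr C \<and>
      Dom C (Inv C (Assoc C U V W)) = TensObj C U (TensObj C V W) \<and>
      Cod C (Inv C (Assoc C U V W)) = TensObj C (TensObj C U V) W"
    if "U \<in> Obj C" "V \<in> Obj C" "W \<in> Obj C" for U V W
    using inv(2)[OF that] that by (simp add: inverse_arrows_def Hom_def C.typing)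
  show "middle_swap D X Y = \<phi> (middle_swap C X Y)" "middle_swap C X Y \<in> Arr C"
    "Dom C (middle_swap C X Y) = TensObj C (TensObj C X X) (TensObj C Y Y)"
    using X Y by (simp_all add: middle_swap_def C.typing inv_typing inv(1) tens_obj ident comp
        tens_arr assoc swap)
qed

lemma markov_category_D: "markov_category D"
proof -
  interpret D: symmetric_monoidal_category D by (rule symmetric_monoidal_category_D)
  note preserved = obj tens_obj unit_obj ident comp tens_arr assoc lunit runit swap copy del
  show ?thesis
  proof unfold_locales
    show "Copy D X \<in> Hom D X (TensObj D X X)" if "X \<in> Obj D" for X
      using that by (simp add: preserved phi_hom C.typing C.copy_hom)
    show "Del D X \<in> Hom D X (UnitObj D)" if "X \<in> Obj D" for X
      using that by (simp add: preserved phi_hom C.typing C.del_hom)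
    show "Comp D (Comp D (Copy D X) (TensArr D (Copy D X) (Ident D X))) (Assoc D X X X) =
        Comp D (Copy D X) (TensArr D (Ident D X) (Copy D X))" if "X \<in> Obj D" for X
      using that by (simp add: C.typing preserved C.copy_coassoc)
    show "Comp D (Comp D (Copy D X) (TensArr D (Del D X) (Ident D X))) (LUnit D X) = Ident D X"
      "Comp D (Comp D (Copy D X) (TensArr D (Ident D X) (Del D X))) (RUnit D X) = Ident D X"
      "Comp D (Copy D X) (Swap D X X) = Copy D X" if "X \<in> Obj D" for X
      using that by (simp_all add: C.typing preserved C.copy_counit_left C.copy_counit_right
          C.copy_commutative)
    show "Copy D (TensObj D X Y) = Comp D (TensArr D (Copy D X) (Copy D Y)) (middle_swap D X Y)"
      if "X \<in> Obj D" "Y \<in> Obj D" for X Y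
      using that by (simp add: C.typing preserved middle_swap C.copy_tens)
    show "Del D (TensObj D X Y) = Comp D (TensArr D (Del D X) (Del D Y)) (LUnit D (UnitObj D))"
      if "X \<in> Obj D" "Y \<in> Obj D" for X Y
      using that by (simp add: C.typing preserved C.del_tens)
    show "Comp D (Copy D (UnitObj D)) (LUnit D (UnitObj D)) = Ident D (UnitObj D)"
      "Del D (UnitObj D) = Ident D (UnitObj D)"
      by (simp_all add: C.typing preserved C.copy_unit C.del_unit)
    show "Comp D f (Del D Y) = Del D X" if f: "f \<in> Hom D X Y" for f X Y
    proof -
      obtain a where a: "f = \<phi> a" "a \<in> Arr C" "Dom C a = X" "Cod C a = Y"
        using f by (elim homE)
      then have "a \<in> Hom C X Y" "X \<in> Obj C" "Y \<in> Obj C"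
        using C.dom_cod_obj by (auto simp: Hom_def)
      with a C.del_natural[of a X Y] show ?thesis
        by (simp add: C.typing preserved)
    qed
  qed
qed

text \<open>Each equation for the inverse is the corresponding equation for \<open>\<phi>\<close>
  after cancelling the two maps. The locale requires its source to be Markov, hence the prior
  transfer of the axioms to \<open>D\<close>.\<close>

lemma strict_markov_iso_inverse: "strict_markov_iso D C (the_inv_into (Arr C) \<phi>)"
proof -
  interpret D: markov_category D by (rule markov_category_D)
  have inv: "the_inv_into (Arr C) \<phi> (\<phi> f) = f" if "f \<in> Arr C" for f
    using bij that by (simp add: bij_betw_def the_inv_into_f_f)
  note preserved = obj tens_obj unit_obj ident comp tens_arr assoc lunit runit swap copy del
  show ?thesis
  proof unfold_locales
    show "bij_betw (the_inv_into (Arr C) \<phi>) (Arr D) (Arr C)"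
      by (rule bij_betw_the_inv_into[OF bij])
  qed (auto elim!: arrE simp: C.typing preserved inv dom cod)
qed

text \<open>Both round trips fix every arrow, and their coherence maps are composites of identities,
  so identities serve as the components of both natural isomorphisms.\<close>

lemma markov_equivalent_D: "markov_equivalent C D"
proof -
  define \<psi> where "\<psi> = the_inv_into (Arr C) \<phi>"
  interpret D: markov_category D by (rule markov_category_D)
  interpret F: strict_markov_functor C D \<phi> ..
  interpret inv: strict_markov_iso D C \<psi>
    unfolding \<psi>_def by (rule strict_markov_iso_inverse)
  interpret G: strict_markov_functor D C \<psi> ..
  have \<psi>\<phi>: "\<psi> (\<phi> f) = f" if "f \<in> Arr C" for f
    using bij that by (simp add: \<psi>_def bij_betw_def the_inv_into_f_f)
  have \<phi>\<psi>: "\<phi> (\<psi> f) = f" if "f \<in> Arr D" for f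
    using bij that by (simp add: \<psi>_def bij_betw_def f_the_inv_into_f)
  note preserved = obj tens_obj unit_obj
  have \<eta>: "markov_nat_iso C C (id_functor C) (comp_functor C F.strict_functor G.strict_functor)
      (Ident C)"
    unfolding markov_nat_iso_def id_functor_def comp_functor_def F.strict_functor_def
        G.strict_functor_def
    using C.copy_hom C.del_hom C.unit_obj
    by (auto simp: preserved \<psi>\<phi> C.ident_hom C.is_iso_ident C.comp_ident_left[OF C.ident_hom]
      C.tens_obj C.tens_ident C.comp_ident_left C.comp_ident_right ident C.typing Hom_def)
  have \<epsilon>: "markov_nat_iso D D (comp_functor D G.strict_functor F.strict_functor) (id_functor D)
      (Ident D)"
    unfolding markov_nat_iso_def id_functor_def comp_functor_def F.strict_functor_def
        G.strict_functor_def
    using D.copy_hom D.del_hom D.unit_obj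
    by (auto simp: inv.obj inv.tens_obj inv.unit_obj \<phi>\<psi> D.ident_hom D.is_iso_ident
        D.comp_ident_left[OF D.ident_hom]
      D.tens_obj D.tens_ident D.comp_ident_left D.comp_ident_right inv.ident D.typing Hom_def)
  show ?thesis
    unfolding markov_equivalent_def
    using F.markov_functor G.markov_functor \<eta> \<epsilon> by blast
qed

end


section \<open>Relations between coordinate spaces\<close>

lemma append_vec_assoc: "(x @\<^sub>v y) @\<^sub>v z = x @\<^sub>v (y @\<^sub>v z)"
  by (rule eq_vecI) auto

lemma vec_first_append [simp]: "x \<in> carrier_vec n \<Longrightarrow> vec_first (x @\<^sub>v y) n = x"
  by (rule eq_vecI) (auto simp: vec_first_def)

lemma vec_last_append [simp]: "y \<in> carrier_vec m \<Longrightarrow> vec_last (x @\<^sub>v y) m = y"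
  by (rule eq_vecI) (auto simp: vec_last_def)

lemma carrier_vec_appendE:
  assumes "x \<in> carrier_vec (n + m)"
  obtains x1 x2 where "x = x1 @\<^sub>v x2" "x1 \<in> carrier_vec n" "x2 \<in> carrier_vec m"
  using vec_first_last_append[OF assms] vec_first_carrier vec_last_carrier by metis

lemma carrier_vec_0: "x \<in> carrier_vec 0 \<longleftrightarrow> x = vNil"
proof
  assume "x \<in> carrier_vec 0"
  then show "x = vNil"
    by (intro eq_vecI) simp_all
qed simp

lemma append_vec_vNil: "x @\<^sub>v vNil = x"
  by (rule eq_vecI) simp_all

lemma smult_append_vec: "a \<cdot>\<^sub>v (x @\<^sub>v y) = (a \<cdot>\<^sub>v x) @\<^sub>v (a \<cdot>\<^sub>v y)"
  by (rule eq_vecI) auto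

section \<open>Total linear relations under composition and block sum\<close>

definition total_linear :: "nat \<Rightarrow> nat \<Rightarrow> (real vec \<times> real vec) set \<Rightarrow> bool" where
  "total_linear n m L \<longleftrightarrow> linear_relation n m L \<and> total_relation n L"

text \<open>Every structure map of \<open>TLinRel\<close> is a graph, so by
  \<open>comp_graph\<close>, \<open>tens_rel_graph\<close> and \<open>graph_cong\<close> many
  equations between them become equations between functions on \<open>carrier_vec n\<close>.\<close>

definition graph_on :: "nat \<Rightarrow> (real vec \<Rightarrow> real vec) \<Rightarrow> (real vec \<times> real vec) set" where
  "graph_on n f = {(x, f x) | x. x \<in> carrier_vec n}"

definition tens_rel :: "(real vec \<times> real vec) set \<Rightarrow> (real vec \<times> real vec) set \<Rightarrow>
    (real vec \<times> real vec) set" where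
  "tens_rel R S = {(x1 @\<^sub>v x2, y1 @\<^sub>v y2) | x1 x2 y1 y2. (x1, y1) \<in> R \<and> (x2, y2) \<in> S}"

lemma graph_on_iff: "(x, y) \<in> graph_on n f \<longleftrightarrow> x \<in> carrier_vec n \<and> y = f x"
  by (auto simp: graph_on_def)

lemma tens_relI: "(x1, y1) \<in> R \<Longrightarrow> (x2, y2) \<in> S \<Longrightarrow> (x1 @\<^sub>v x2, y1 @\<^sub>v y2) \<in> tens_rel R S"
  unfolding tens_rel_def by blast

lemma tens_relE:
  assumes "(x, y) \<in> tens_rel R S"
  obtains x1 x2 y1 y2 where "x = x1 @\<^sub>v x2" "y = y1 @\<^sub>v y2" "(x1, y1) \<in> R" "(x2, y2) \<in> S"
  using assms unfolding tens_rel_def by blast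

lemma total_linear_carrier: "total_linear n m L \<Longrightarrow> (x, y) \<in> L \<Longrightarrow> x \<in> carrier_vec n \<and>
    y \<in> carrier_vec m"
  by (auto simp: total_linear_def linear_relation_def)

lemma total_linear_total: "total_linear n m L \<Longrightarrow> x \<in> carrier_vec n \<Longrightarrow> \<exists>y. (x, y) \<in> L"
  by (auto simp: total_linear_def total_relation_def)

lemma total_linear_zero: "total_linear n m L \<Longrightarrow> (0\<^sub>v n, 0\<^sub>v m) \<in> L"
  by (auto simp: total_linear_def linear_relation_def)

lemma total_linear_add: "total_linear n m L \<Longrightarrow> (x, y) \<in> L \<Longrightarrow> (x', y') \<in> L \<Longrightarrow> (x + x', y + y') \<in> L"
  by (auto simp: total_linear_def linear_relation_def)

lemma total_linear_smult: "total_linear n m L \<Longrightarrow> (x, y) \<in> L \<Longrightarrow> (a \<cdot>\<^sub>v x, a \<cdot>\<^sub>v y) \<in> L"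
  by (auto simp: total_linear_def linear_relation_def)

text \<open>The pair of zero vectors comes from the other conditions: totality relates zero to some
  \<open>y\<close>, and scaling that pair by the scalar 0 also sends \<open>y\<close> to
  zero.\<close>

lemma total_linearI:
  assumes "\<And>x y. (x, y) \<in> L \<Longrightarrow> x \<in> carrier_vec n \<and> y \<in> carrier_vec m"
    and "\<And>x y x' y'. (x, y) \<in> L \<Longrightarrow> (x', y') \<in> L \<Longrightarrow> (x + x', y + y') \<in> L"
    and "\<And>a x y. (x, y) \<in> L \<Longrightarrow> (a \<cdot>\<^sub>v x, a \<cdot>\<^sub>v y) \<in> L"
    and total: "\<And>x. x \<in> carrier_vec n \<Longrightarrow> \<exists>y. (x, y) \<in> L"
  shows "total_linear n m L"
proof -
  obtain y where y: "(0\<^sub>v n, y) \<in> L"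
    using total[of "0\<^sub>v n"] by auto
  moreover have "0 \<cdot>\<^sub>v 0\<^sub>v n = (0\<^sub>v n :: real vec)" "0 \<cdot>\<^sub>v y = 0\<^sub>v m"
    using assms(1)[OF y] by auto
  ultimately have "(0\<^sub>v n, 0\<^sub>v m) \<in> L"
    using assms(3)[OF y, of 0] by simp
  then show ?thesis
    unfolding total_linear_def linear_relation_def total_relation_def by (auto simp: assms)
qed

lemma total_linear_comp: assumes R: "total_linear n m R" and S: "total_linear m l S"
    shows "total_linear n l (R O S)"
proof (rule total_linearI)
  show "x \<in> carrier_vec n \<and> z \<in> carrier_vec l" if "(x, z) \<in> R O S" for x z
    using that total_linear_carrier[OF R] total_linear_carrier[OF S] by blast
  show "(x + x', z + z') \<in> R O S" if "(x, z) \<in> R O S" "(x', z') \<in> R O S" for x z x' z'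
  proof -
    from that obtain y y' where "(x, y) \<in> R" "(y, z) \<in> S" "(x', y') \<in> R" "(y', z') \<in> S"
      by blast
    then show ?thesis
      using total_linear_add[OF R, of x y x' y'] total_linear_add[OF S, of y z y' z'] by blast
  qed
  show "(a \<cdot>\<^sub>v x, a \<cdot>\<^sub>v z) \<in> R O S" if "(x, z) \<in> R O S" for a x z
  proof -
    from that obtain y where "(x, y) \<in> R" "(y, z) \<in> S"
      by blast
    then show ?thesis
      using total_linear_smult[OF R, of x y a] total_linear_smult[OF S, of y z a] by blast
  qed
  show "\<exists>z. (x, z) \<in> R O S" if x: "x \<in> carrier_vec n" for x
  proof -
    obtain y where y: "(x, y) \<in> R"
      using total_linear_total[OF R x] by blast
    then have "y \<in> carrier_vec m"
      using total_linear_carrier[OF R] by blast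
    then obtain z where "(y, z) \<in> S"
      using total_linear_total[OF S] by blast
    with y show ?thesis by blast
  qed
qed

lemma total_linear_tens: assumes R: "total_linear n m R" and S: "total_linear n' m' S"
    shows "total_linear (n + n') (m + m') (tens_rel R S)"
proof (rule total_linearI)
  show "x \<in> carrier_vec (n + n') \<and> y \<in> carrier_vec (m + m')" if "(x, y) \<in> tens_rel R S" for x y
    using that by (rule tens_relE)
        (use total_linear_carrier[OF R] total_linear_carrier[OF S] in simp)
  show "(x + x', y + y') \<in> tens_rel R S" if "(x, y) \<in> tens_rel R S" "(x', y') \<in> tens_rel R S"
      for x y x' y'
  proof -
    from that obtain x1 x2 y1 y2 x1' x2' y1' y2' where *:
      "x = x1 @\<^sub>v x2" "y = y1 @\<^sub>v y2" "(x1, y1) \<in> R" "(x2, y2) \<in> S"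
      "x' = x1' @\<^sub>v x2'" "y' = y1' @\<^sub>v y2'" "(x1', y1') \<in> R" "(x2', y2') \<in> S"
      unfolding tens_rel_def by blast
    have "x1 \<in> carrier_vec n" "x2 \<in> carrier_vec n'" "y1 \<in> carrier_vec m" "y2 \<in> carrier_vec m'"
      "x1' \<in> carrier_vec n" "x2' \<in> carrier_vec n'" "y1' \<in> carrier_vec m" "y2' \<in> carrier_vec m'"
      using * total_linear_carrier[OF R] total_linear_carrier[OF S] by blast+
    then have "x + x' = (x1 + x1') @\<^sub>v (x2 + x2')" "y + y' = (y1 + y1') @\<^sub>v (y2 + y2')"
      using * by (simp_all add: append_vec_add)
    then show ?thesis
      using total_linear_add[OF R *(3) *(7)] total_linear_add[OF S *(4) *(8)] unfolding
          tens_rel_def by blast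
  qed
  show "(a \<cdot>\<^sub>v x, a \<cdot>\<^sub>v y) \<in> tens_rel R S" if "(x, y) \<in> tens_rel R S" for a x y
  proof -
    from that obtain x1 x2 y1 y2 where
      "x = x1 @\<^sub>v x2" "y = y1 @\<^sub>v y2" "(x1, y1) \<in> R" "(x2, y2) \<in> S"
      unfolding tens_rel_def by blast
    then show ?thesis
      using total_linear_smult[OF R, of x1 y1 a] total_linear_smult[OF S, of x2 y2 a]
      by (simp add: smult_append_vec tens_relI)
  qed
  show "\<exists>y. (x, y) \<in> tens_rel R S" if "x \<in> carrier_vec (n + n')" for x
    using that
  proof (rule carrier_vec_appendE)
    fix x1 x2 assume x: "x = x1 @\<^sub>v x2" "x1 \<in> carrier_vec n" "x2 \<in> carrier_vec n'"
    obtain y1 where y1: "(x1, y1) \<in> R"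
      using total_linear_total[OF R x(2)] by blast
    obtain y2 where y2: "(x2, y2) \<in> S"
      using total_linear_total[OF S x(3)] by blast
    show ?thesis
      using tens_relI[OF y1 y2] x(1) by blast
  qed
qed

lemma total_linear_graph:
  assumes "\<And>x. x \<in> carrier_vec n \<Longrightarrow> f x \<in> carrier_vec m"
    and "\<And>x y. x \<in> carrier_vec n \<Longrightarrow> y \<in> carrier_vec n \<Longrightarrow> f (x + y) = f x + f y"
    and "\<And>a x. x \<in> carrier_vec n \<Longrightarrow> f (a \<cdot>\<^sub>v x) = a \<cdot>\<^sub>v f x"
  shows "total_linear n m (graph_on n f)"
  by (rule total_linearI) (auto simp: graph_on_iff assms)

text \<open>One inclusion is immediate. For the other, the middle vector is split once by the first
  pair of relations and once by the second; both left blocks have length \<open>m\<close>, so the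
  two splittings coincide.\<close>

lemma tens_rel_comp:
  assumes "total_linear n m R" "total_linear m l S" "total_linear n' m' R'" "total_linear m' l' S'"
  shows "tens_rel (R O S) (R' O S') = tens_rel R R' O tens_rel S S'"
proof
  show "tens_rel (R O S) (R' O S') \<subseteq> tens_rel R R' O tens_rel S S'"
    unfolding tens_rel_def by blast
  show "tens_rel R R' O tens_rel S S' \<subseteq> tens_rel (R O S) (R' O S')"
  proof clarify
    fix x y z assume "(x, y) \<in> tens_rel R R'" "(y, z) \<in> tens_rel S S'"
    then obtain x1 x2 y1 y2 y1' y2' z1 z2 where *:
      "x = x1 @\<^sub>v x2" "y = y1 @\<^sub>v y2" "(x1, y1) \<in> R" "(x2, y2) \<in> R'"
      "y = y1' @\<^sub>v y2'" "z = z1 @\<^sub>v z2" "(y1', z1) \<in> S" "(y2', z2) \<in> S'"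
      unfolding tens_rel_def by blast
    then have "y1' = y1 \<and> y2' = y2"
      using total_linear_carrier[OF assms(1)] total_linear_carrier[OF assms(2)] append_vec_eq[of
          y1 m y1'] by metis
    then show "(x, z) \<in> tens_rel (R O S) (R' O S')"
      using * unfolding tens_rel_def by blast
  qed
qed

lemma tens_rel_assoc: "tens_rel (tens_rel R S) T = tens_rel R (tens_rel S T)"
proof -
  have "tens_rel (tens_rel R S) T = {((x @\<^sub>v y) @\<^sub>v z, (x' @\<^sub>v y') @\<^sub>v z') | x y z x' y' z'.
      (x, x') \<in> R \<and> (y, y') \<in> S \<and> (z, z') \<in> T}"
    unfolding tens_rel_def by blast
  also have "\<dots> = tens_rel R (tens_rel S T)"
    unfolding tens_rel_def append_vec_assoc by blast
  finally show ?thesis .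
qed

lemma tens_rel_graph:
  "tens_rel (graph_on n f) (graph_on m g) =
      graph_on (n + m) (\<lambda>x. f (vec_first x n) @\<^sub>v g (vec_last x m))"
proof (intro equalityI subrelI)
  fix x y assume "(x, y) \<in> tens_rel (graph_on n f) (graph_on m g)"
  then show "(x, y) \<in> graph_on (n + m) (\<lambda>x. f (vec_first x n) @\<^sub>v g (vec_last x m))"
    by (rule tens_relE) (simp add: graph_on_iff)
next
  fix x y assume xy: "(x, y) \<in> graph_on (n + m) (\<lambda>x. f (vec_first x n) @\<^sub>v g (vec_last x m))"
  have "(vec_first x n, f (vec_first x n)) \<in> graph_on n f"
      "(vec_last x m, g (vec_last x m)) \<in> graph_on m g"
    by (simp_all add: graph_on_iff)
  from tens_relI[OF this] xy
  show "(x, y) \<in> tens_rel (graph_on n f) (graph_on m g)"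
    by (simp add: graph_on_iff)
qed

lemma comp_graph:
  "(\<And>x. x \<in> carrier_vec n \<Longrightarrow> f x \<in> carrier_vec m) \<Longrightarrow> graph_on n f O graph_on m g =
      graph_on n (\<lambda>x. g (f x))"
  unfolding graph_on_def by blast

lemma graph_cong: "(\<And>x. x \<in> carrier_vec n \<Longrightarrow> f x = g x) \<Longrightarrow> graph_on n f = graph_on n g"
  unfolding graph_on_def by auto

lemma tens_rel_unit: "tens_rel (graph_on 0 (\<lambda>x. x)) R = R" "tens_rel R (graph_on 0 (\<lambda>x. x)) = R"
  unfolding tens_rel_def graph_on_def by (simp_all add: carrier_vec_0 append_vec_vNil)

lemma ident_rel: assumes "total_linear n m R" shows "graph_on n (\<lambda>x. x) O R = R"
    "R O graph_on m (\<lambda>x. x) = R"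
  by (auto simp: relcomp_unfold graph_on_iff dest: total_linear_carrier[OF assms])

lemma tens_ident_rel: "tens_rel (graph_on n (\<lambda>x. x)) (graph_on m (\<lambda>x. x)) =
    graph_on (n + m) (\<lambda>x. x)"
  unfolding tens_rel_graph by (rule graph_cong) simp

section \<open>Symmetry, copying and deletion as relations\<close>

definition swap_rel :: "nat \<Rightarrow> nat \<Rightarrow> (real vec \<times> real vec) set" where
  "swap_rel n m = graph_on (n + m) (\<lambda>x. vec_last x m @\<^sub>v vec_first x n)"

lemma append_carrier_vec': "v \<in> carrier_vec n \<Longrightarrow> w \<in> carrier_vec m \<Longrightarrow> v @\<^sub>v w \<in> carrier_vec (m + n)"
  using append_carrier_vec[of v n w m] by (simp add: add.commute)

lemma vec_first_add: "dim_vec x = dim_vec y \<Longrightarrow> n \<le> dim_vec x \<Longrightarrow> vec_first (x + y) n =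
    vec_first x n + vec_first y n"
  by (rule eq_vecI) (auto simp: vec_first_def)

lemma vec_last_add: "dim_vec x = dim_vec y \<Longrightarrow> n \<le> dim_vec x \<Longrightarrow> vec_last (x + y) n =
    vec_last x n + vec_last y n"
  by (rule eq_vecI) (auto simp: vec_last_def)

lemma vec_first_smult: "n \<le> dim_vec x \<Longrightarrow> vec_first (a \<cdot>\<^sub>v x) n = a \<cdot>\<^sub>v vec_first x n"
  by (rule eq_vecI) (auto simp: vec_first_def)

lemma vec_last_smult: "n \<le> dim_vec x \<Longrightarrow> vec_last (a \<cdot>\<^sub>v x) n = a \<cdot>\<^sub>v vec_last x n"
  by (rule eq_vecI) (auto simp: vec_last_def)

lemma total_linear_swap: "total_linear (n + m) (m + n) (swap_rel n m)"
  unfolding swap_rel_def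
proof (rule total_linear_graph)
  fix x y :: "real vec" assume "x \<in> carrier_vec (n + m)" "y \<in> carrier_vec (n + m)"
  then show "vec_last (x + y) m @\<^sub>v vec_first (x + y) n =
      (vec_last x m @\<^sub>v vec_first x n) + (vec_last y m @\<^sub>v vec_first y n)"
    by (simp add: vec_first_add vec_last_add append_vec_add[OF vec_last_carrier vec_last_carrier
        vec_first_carrier vec_first_carrier])
next
  fix a and x :: "real vec" assume "x \<in> carrier_vec (n + m)"
  then show "vec_last (a \<cdot>\<^sub>v x) m @\<^sub>v vec_first (a \<cdot>\<^sub>v x) n =
      a \<cdot>\<^sub>v (vec_last x m @\<^sub>v vec_first x n)"
    by (simp add: vec_first_smult vec_last_smult smult_append_vec)
qed simp

lemma total_linear_ident: "total_linear n n (graph_on n (\<lambda>x. x))"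
  by (rule total_linear_graph) auto

lemma total_linear_copy: "total_linear n (n + n) (graph_on n (\<lambda>x. x @\<^sub>v x))"
  by (rule total_linear_graph) (auto simp: append_vec_add smult_append_vec)

lemma total_linear_del: "total_linear n 0 (graph_on n (\<lambda>x. vNil))"
  by (rule total_linear_graph) auto

lemma swap_relI: "x \<in> carrier_vec n \<Longrightarrow> y \<in> carrier_vec m \<Longrightarrow> (x @\<^sub>v y, y @\<^sub>v x) \<in> swap_rel n m"
  by (simp add: swap_rel_def graph_on_iff)

lemma swap_relD:
  "(x @\<^sub>v y, z) \<in> swap_rel n m \<Longrightarrow> x \<in> carrier_vec n \<Longrightarrow> y \<in> carrier_vec m \<Longrightarrow> z = y @\<^sub>v x"
  by (simp add: swap_rel_def graph_on_iff)

lemma swap_natural_rel: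
  assumes R: "total_linear n n' R" and S: "total_linear m m' S"
  shows "tens_rel R S O swap_rel n' m' = swap_rel n m O tens_rel S R"
proof (intro equalityI subrelI)
  fix x z assume "(x, z) \<in> tens_rel R S O swap_rel n' m'"
  then obtain y where y: "(x, y) \<in> tens_rel R S" "(y, z) \<in> swap_rel n' m'"
    by blast
  from y(1) show "(x, z) \<in> swap_rel n m O tens_rel S R"
  proof (rule tens_relE)
    fix x1 x2 y1 y2 assume *: "x = x1 @\<^sub>v x2" "y = y1 @\<^sub>v y2" "(x1, y1) \<in> R" "(x2, y2) \<in> S"
    with y(2) total_linear_carrier[OF R *(3)] total_linear_carrier[OF S *(4)] have "z = y2 @\<^sub>v y1"
      by (simp add: swap_relD)
    with * total_linear_carrier[OF R *(3)] total_linear_carrier[OF S *(4)]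
    show ?thesis
      using swap_relI[of x1 n x2 m] tens_relI[OF *(4) *(3)] by blast
  qed
next
  fix x z assume "(x, z) \<in> swap_rel n m O tens_rel S R"
  then obtain y where y: "(x, y) \<in> swap_rel n m" "(y, z) \<in> tens_rel S R"
    by blast
  from y(2) show "(x, z) \<in> tens_rel R S O swap_rel n' m'"
  proof (rule tens_relE)
    fix y1 y2 z1 z2 assume *: "y = y1 @\<^sub>v y2" "z = z1 @\<^sub>v z2" "(y1, z1) \<in> S" "(y2, z2) \<in> R"
    \<comment> \<open>The swap is read backwards: \<open>y1\<close> has the same length
      \<open>m\<close> as the last block of \<open>x\<close>, so comparing blocks recovers both
      parts of \<open>x\<close>.\<close>
    have x: "x \<in> carrier_vec (n + m)" "vec_last x m @\<^sub>v vec_first x n = y1 @\<^sub>v y2"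
      using y(1) * by (auto simp: swap_rel_def graph_on_iff)
    then have "vec_last x m = y1" "vec_first x n = y2"
      using total_linear_carrier[OF S *(3)] append_vec_eq[of "vec_last x m" m y1 "vec_first x n"
          y2] by simp_all
    then have "x = y2 @\<^sub>v y1"
      using x(1) vec_first_last_append by metis
    then show ?thesis
      using * tens_relI[OF *(4) *(3)] swap_relI[of z2 n' z1 m'] total_linear_carrier[OF R *(4)]
          total_linear_carrier[OF S *(3)]
      by blast
  qed
qed

lemma swap_swap_rel: "swap_rel n m O swap_rel m n = graph_on (n + m) (\<lambda>x. x)"
  unfolding swap_rel_def
  by (subst comp_graph; (rule graph_cong)?) (auto simp: add.commute)

text \<open>With associators equal to identities, the hexagon says that moving \<open>x\<close> past
  a pair of blocks is moving it past each in turn. The right side is computed as one graph, and the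
  two block functions are then compared coordinate by coordinate.\<close>

lemma hexagon_rel:
  "swap_rel n (m + k) = tens_rel (swap_rel n m) (graph_on k (\<lambda>x. x)) O
      tens_rel (graph_on m (\<lambda>x. x)) (swap_rel n k)"
proof -
  have "tens_rel (swap_rel n m) (graph_on k (\<lambda>x. x)) O
      tens_rel (graph_on m (\<lambda>x. x)) (swap_rel n k) =
    graph_on (n + m + k) (\<lambda>x. vec_first
        (((vec_last (vec_first x (n + m)) m @\<^sub>v vec_first (vec_first x (n + m)) n) @\<^sub>v vec_last x
        k)) m
       @\<^sub>v (vec_last (vec_last
           ((vec_last (vec_first x (n + m)) m @\<^sub>v vec_first (vec_first x (n + m)) n) @\<^sub>v vec_last
           x k) (n + k)) k
       @\<^sub>v vec_first (vec_last
           ((vec_last (vec_first x (n + m)) m @\<^sub>v vec_first (vec_first x (n + m)) n) @\<^sub>v vec_last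
           x k) (n + k)) n))"
    unfolding swap_rel_def tens_rel_graph
    by (rule comp_graph) (auto intro!: append_carrier_vec simp: add.assoc[symmetric]
        append_carrier_vec')
  also have "\<dots> = swap_rel n (m + k)"
    unfolding swap_rel_def add.assoc
    by (rule graph_cong, rule eq_vecI) (auto simp: vec_first_def vec_last_def add.commute[of k m])
  finally show ?thesis ..
qed

text \<open>The copies produce the blocks \<open>x1 x1 x2 x2\<close>, and exchanging the two inner
  ones gives \<open>x1 x2 x1 x2\<close>, which is \<open>x @\<^sub>v x\<close>. Since concatenation
  is strictly associative, the same vector may be bracketed as two pairs for the copies and as
  outer, inner and outer part for the exchange.\<close>

lemma copy_tens_rel:
  "graph_on (n + m) (\<lambda>x. x @\<^sub>v x) =
    tens_rel (graph_on n (\<lambda>x. x @\<^sub>v x)) (graph_on m (\<lambda>x. x @\<^sub>v x)) O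
    tens_rel (graph_on n (\<lambda>x. x)) (tens_rel (swap_rel n m) (graph_on m (\<lambda>x. x)))"
proof (intro equalityI subrelI)
  fix x y :: "real vec" assume "(x, y) \<in> graph_on (n + m) (\<lambda>x. x @\<^sub>v x)"
  then have "x \<in> carrier_vec (n + m)" and y: "y = x @\<^sub>v x"
    by (simp_all add: graph_on_iff)
  from this(1) show "(x, y) \<in> tens_rel (graph_on n (\<lambda>x. x @\<^sub>v x)) (graph_on m (\<lambda>x. x @\<^sub>v x)) O
    tens_rel (graph_on n (\<lambda>x. x)) (tens_rel (swap_rel n m) (graph_on m (\<lambda>x. x)))"
  proof (rule carrier_vec_appendE)
    fix x1 x2 assume x: "x = x1 @\<^sub>v x2" "x1 \<in> carrier_vec n" "x2 \<in> carrier_vec m"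
    then have "(x, (x1 @\<^sub>v x1) @\<^sub>v (x2 @\<^sub>v x2)) \<in> tens_rel (graph_on n (\<lambda>x. x @\<^sub>v x))
        (graph_on m (\<lambda>x. x @\<^sub>v x))"
      by (simp add: tens_relI graph_on_iff)
    moreover have "(x1 @\<^sub>v ((x1 @\<^sub>v x2) @\<^sub>v x2), x1 @\<^sub>v ((x2 @\<^sub>v x1) @\<^sub>v x2)) \<in>
        tens_rel (graph_on n (\<lambda>x. x)) (tens_rel (swap_rel n m) (graph_on m (\<lambda>x. x)))"
      using x by (intro tens_relI swap_relI) (simp_all add: graph_on_iff)
    ultimately show ?thesis
      unfolding y x(1) append_vec_assoc by blast
  qed
next
  fix x z assume "(x, z) \<in> tens_rel (graph_on n (\<lambda>x. x @\<^sub>v x)) (graph_on m (\<lambda>x. x @\<^sub>v x)) O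
    tens_rel (graph_on n (\<lambda>x. x)) (tens_rel (swap_rel n m) (graph_on m (\<lambda>x. x)))"
  then obtain y where y: "(x, y) \<in> tens_rel (graph_on n (\<lambda>x. x @\<^sub>v x)) (graph_on m (\<lambda>x. x @\<^sub>v x))"
    "(y, z) \<in> tens_rel (graph_on n (\<lambda>x. x)) (tens_rel (swap_rel n m) (graph_on m (\<lambda>x. x)))"
    by blast
  from y(1) obtain x1 x2 where x: "x = x1 @\<^sub>v x2" "y = (x1 @\<^sub>v x1) @\<^sub>v (x2 @\<^sub>v x2)"
      "x1 \<in> carrier_vec n" "x2 \<in> carrier_vec m"
    by (elim tens_relE) (simp add: graph_on_iff)
  from y(2) obtain y1 y2 y3 z2 where yz: "y = y1 @\<^sub>v (y2 @\<^sub>v y3)" "z = y1 @\<^sub>v (z2 @\<^sub>v y3)"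
    "y1 \<in> carrier_vec n" "(y2, z2) \<in> swap_rel n m"  "y3 \<in> carrier_vec m"
    by (elim tens_relE) (auto simp: graph_on_iff)
  have "y2 \<in> carrier_vec (n + m)"
    using yz(4) by (simp add: swap_rel_def graph_on_iff)
  \<comment> \<open>Both sides are bracketings of the middle vector \<open>y\<close> with block
    lengths \<open>n\<close>, \<open>n + m\<close> and \<open>m\<close>, so the blocks can be
    equated one by one.\<close>
  moreover have "y1 @\<^sub>v (y2 @\<^sub>v y3) = x1 @\<^sub>v ((x1 @\<^sub>v x2) @\<^sub>v x2)"
    using x yz by (simp add: append_vec_assoc)
  ultimately have "y1 = x1" "y2 = x1 @\<^sub>v x2" "y3 = x2"
    using x yz append_vec_eq[of y1 n x1] append_vec_eq[of y2 "n + m" "x1 @\<^sub>v x2"] by auto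
  then have "z = x @\<^sub>v x"
    using yz x swap_relD[of x1 x2 z2 n m] by (simp add: append_vec_assoc)
  then show "(x, z) \<in> graph_on (n + m) (\<lambda>x. x @\<^sub>v x)"
    using x by (simp add: graph_on_iff)
qed

lemma copy_coassoc_rel:
  "graph_on n (\<lambda>x. x @\<^sub>v x) O tens_rel (graph_on n (\<lambda>x. x @\<^sub>v x)) (graph_on n (\<lambda>x. x)) =
   graph_on n (\<lambda>x. x @\<^sub>v x) O tens_rel (graph_on n (\<lambda>x. x)) (graph_on n (\<lambda>x. x @\<^sub>v x))"
  by (simp add: tens_rel_graph comp_graph append_vec_assoc cong: graph_cong)

lemma copy_counit_rel:
  "graph_on n (\<lambda>x. x @\<^sub>v x) O tens_rel (graph_on n (\<lambda>x. vNil)) (graph_on n (\<lambda>x. x)) =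
      graph_on n (\<lambda>x. x)"
  "graph_on n (\<lambda>x. x @\<^sub>v x) O tens_rel (graph_on n (\<lambda>x. x)) (graph_on n (\<lambda>x. vNil)) =
      graph_on n (\<lambda>x. x)"
  by (simp_all add: tens_rel_graph comp_graph append_vec_vNil cong: graph_cong)

lemma copy_commutative_rel: "graph_on n (\<lambda>x. x @\<^sub>v x) O swap_rel n n = graph_on n (\<lambda>x. x @\<^sub>v x)"
  by (simp add: swap_rel_def comp_graph cong: graph_cong)

lemma del_tens_rel: "graph_on (n + m) (\<lambda>x. vNil) =
    tens_rel (graph_on n (\<lambda>x. vNil)) (graph_on m (\<lambda>x. vNil))"
  by (simp add: tens_rel_graph)

lemma del_unit_rel: "graph_on 0 (\<lambda>x. vNil) = graph_on 0 (\<lambda>x. x)"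
    "graph_on 0 (\<lambda>x. x @\<^sub>v x) = graph_on 0 (\<lambda>x. x)"
  by (rule graph_cong; simp add: carrier_vec_0)+

text \<open>This is where totality is felt: \<open>R\<close> followed by deletion reaches the empty
  vector exactly from those \<open>x\<close> that \<open>R\<close> relates to something.\<close>

lemma del_natural_rel: assumes R: "total_linear n m R"
    shows "R O graph_on m (\<lambda>x. vNil) = graph_on n (\<lambda>x. vNil)"
proof (intro equalityI subrelI)
  fix x y :: "real vec" assume "(x, y) \<in> graph_on n (\<lambda>x. vNil)"
  then have "x \<in> carrier_vec n" "y = vNil" by (simp_all add: graph_on_iff)
  moreover from this obtain z where "(x, z) \<in> R" using total_linear_total[OF R] by blast
  ultimately show "(x, y) \<in> R O graph_on m (\<lambda>x. vNil)"
    using total_linear_carrier[OF R] by (auto simp: relcomp_unfold graph_on_iff)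
qed (auto simp: graph_on_iff dest: total_linear_carrier[OF R])


section \<open>The Markov category of total linear relations\<close>

lemma TLinRel_simps:
  "Obj TLinRel = UNIV"
  "(n, m, L) \<in> Arr TLinRel \<longleftrightarrow> total_linear n m L"
  "Dom TLinRel (n, m, L) = n"
  "Cod TLinRel (n, m, L) = m"
  "Ident TLinRel n = (n, n, graph_on n (\<lambda>x. x))"
  "Comp TLinRel (n, m, R) (m', k, S) = (n, k, R O S)"
  "TensObj TLinRel = (+)"
  "TensArr TLinRel (n, m, R) (n', m', S) = (n + n', m + m', tens_rel R S)"
  "UnitObj TLinRel = 0"
  "LUnit TLinRel n = (n, n, graph_on n (\<lambda>x. x))"
  "RUnit TLinRel n = (n, n, graph_on n (\<lambda>x. x))"
  "Copy TLinRel n = (n, n + n, graph_on n (\<lambda>x. x @\<^sub>v x))"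
  "Del TLinRel n = (n, 0, graph_on n (\<lambda>x. vNil))"
  unfolding TLinRel_def by (auto simp: total_linear_def graph_on_def tens_rel_def append_vec_vNil)

lemma TLinRel_Assoc: "Assoc TLinRel n m k = Ident TLinRel (n + m + k)"
proof -
  have "{((x @\<^sub>v y) @\<^sub>v z, x @\<^sub>v (y @\<^sub>v z)) | x y z.
      x \<in> carrier_vec n \<and> y \<in> carrier_vec m \<and> z \<in> carrier_vec k} = graph_on (n + m + k) (\<lambda>x. x)"
    (is "?A = _")
  proof (intro equalityI subrelI)
    fix x y assume "(x, y) \<in> ?A"
    then show "(x, y) \<in> graph_on (n + m + k) (\<lambda>x. x)"
      by (auto simp: graph_on_iff append_vec_assoc add.assoc)
  next
    fix x y :: "real vec" assume "(x, y) \<in> graph_on (n + m + k) (\<lambda>x. x)"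
    then have "x \<in> carrier_vec (n + m + k)" and y: "y = x"
      by (simp_all add: graph_on_iff)
    then obtain x1 x2 x3 where "x = (x1 @\<^sub>v x2) @\<^sub>v x3"
      "x1 \<in> carrier_vec n" "x2 \<in> carrier_vec m" "x3 \<in> carrier_vec k"
      by (metis carrier_vec_appendE)
    then show "(x, y) \<in> ?A"
      unfolding y append_vec_assoc by blast
  qed
  then show ?thesis
    by (simp add: TLinRel_def graph_on_def Id_on_def' add.assoc) auto
qed

lemma TLinRel_Swap: "Swap TLinRel n m = (n + m, m + n, swap_rel n m)"
proof -
  have "{(x @\<^sub>v y, y @\<^sub>v x) | x y. x \<in> carrier_vec n \<and> y \<in> carrier_vec m} = swap_rel n m"
    (is "?A = _")
  proof (intro equalityI subrelI)
    fix x y assume "(x, y) \<in> swap_rel n m"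
    then have "x \<in> carrier_vec (n + m)" "y = vec_last x m @\<^sub>v vec_first x n"
      by (simp_all add: swap_rel_def graph_on_iff)
    then show "(x, y) \<in> ?A"
      using vec_first_last_append[of x n m] vec_first_carrier vec_last_carrier
      by (metis (mono_tags, lifting) mem_Collect_eq)
  qed (auto intro: swap_relI)
  then show ?thesis
    by (simp add: TLinRel_def)
qed

lemma TLinRel_Hom: "f \<in> Hom TLinRel X Y \<longleftrightarrow> (\<exists>R. f = (X, Y, R) \<and> total_linear X Y R)"
  by (cases f) (auto simp: Hom_def TLinRel_simps)

interpretation TLinRel: category TLinRel
proof
  show "Dom TLinRel f \<in> Obj TLinRel \<and> Cod TLinRel f \<in> Obj TLinRel" for f
    by (simp add: TLinRel_simps)
  show "Ident TLinRel X \<in> Hom TLinRel X X" for X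
    by (simp add: TLinRel_Hom TLinRel_simps total_linear_ident)
  show "Comp TLinRel f g \<in> Hom TLinRel X Z" if "f \<in> Hom TLinRel X Y" "g \<in> Hom TLinRel Y Z"
      for f g X Y Z
    using that by (auto simp: TLinRel_Hom TLinRel_simps intro: total_linear_comp)
  show "Comp TLinRel (Ident TLinRel X) f = f" "Comp TLinRel f (Ident TLinRel Y) = f"
    if "f \<in> Hom TLinRel X Y" for f X Y
    using that by (auto simp: TLinRel_Hom TLinRel_simps ident_rel)
  show "Comp TLinRel (Comp TLinRel f g) h = Comp TLinRel f (Comp TLinRel g h)"
    if "f \<in> Hom TLinRel W X" "g \<in> Hom TLinRel X Y" "h \<in> Hom TLinRel Y Z" for f g h W X Y Z
    using that by (auto simp: TLinRel_Hom TLinRel_simps O_assoc)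
qed

lemma ident_ident_rel: "graph_on n (\<lambda>x. x) O graph_on n (\<lambda>x. x) = graph_on n (\<lambda>x. x)"
  by (rule ident_rel[OF total_linear_ident])

text \<open>Dimensions are sums whose bracketing has to match before \<open>ident_rel\<close> can
  absorb an associator; this brings a nested tensor to the bracketing in which the associator is
  stated.\<close>

lemma total_linear_assoc: "total_linear (n + (m + k)) (n' + (m' + k')) R \<Longrightarrow>
    total_linear (n + m + k) (n' + m' + k') R"
  by (simp add: add.assoc)

interpretation TLinRel: symmetric_monoidal_category TLinRel
proof
  note simps = TLinRel_Hom TLinRel_simps TLinRel_Assoc TLinRel_Swap tens_rel_unit ident_ident_rel
    tens_ident_rel ident_rel total_linear_ident total_linear_swap total_linear_tens
        total_linear_comp
  show "UnitObj TLinRel \<in> Obj TLinRel" "TensObj TLinRel X Y \<in> Obj TLinRel" for X Y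
    by (simp_all add: simps)
  show "TensArr TLinRel f g \<in> Hom TLinRel (TensObj TLinRel X X') (TensObj TLinRel Y Y')"
    if "f \<in> Hom TLinRel X Y" "g \<in> Hom TLinRel X' Y'" for f g X Y X' Y'
    using that by (auto simp: simps)
  show "TensArr TLinRel (Ident TLinRel X) (Ident TLinRel Y) = Ident TLinRel (TensObj TLinRel X Y)"
      for X Y
    by (simp add: simps)
  show "TensArr TLinRel (Comp TLinRel f g) (Comp TLinRel f' g') =
      Comp TLinRel (TensArr TLinRel f f') (TensArr TLinRel g g')"
    if fg: "f \<in> Hom TLinRel X Y" "g \<in> Hom TLinRel Y Z" "f' \<in> Hom TLinRel X' Y'"
        "g' \<in> Hom TLinRel Y' Z'"
    for f g f' g' X Y Z X' Y' Z'
  proof -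
    obtain R S R' S' where *: "f = (X, Y, R)" "total_linear X Y R" "g = (Y, Z, S)"
        "total_linear Y Z S"
      "f' = (X', Y', R')" "total_linear X' Y' R'" "g' = (Y', Z', S')" "total_linear Y' Z' S'"
      using fg by (auto simp: TLinRel_Hom)
    from tens_rel_comp[OF *(2,4,6,8)] show ?thesis
      by (simp add: * TLinRel_simps)
  qed
  show "Assoc TLinRel X Y Z \<in> Hom TLinRel (TensObj TLinRel (TensObj TLinRel X Y) Z)
      (TensObj TLinRel X (TensObj TLinRel Y Z))"
    "is_iso TLinRel (Assoc TLinRel X Y Z)" for X Y Z
    using TLinRel.is_iso_ident[of "X + Y + Z"] by (simp_all add: simps add.assoc)
  show "Comp TLinRel (TensArr TLinRel (TensArr TLinRel f g) h) (Assoc TLinRel X' Y' Z') =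
      Comp TLinRel (Assoc TLinRel X Y Z) (TensArr TLinRel f (TensArr TLinRel g h))"
    if fgh: "f \<in> Hom TLinRel X X'" "g \<in> Hom TLinRel Y Y'" "h \<in> Hom TLinRel Z Z'"
        for f g h X Y Z X' Y' Z'
  proof -
    obtain R S T where *: "f = (X, X', R)" "total_linear X X' R" "g = (Y, Y', S)"
        "total_linear Y Y' S"
      "h = (Z, Z', T)" "total_linear Z Z' T"
      using fgh by (auto simp: TLinRel_Hom)
    then have "total_linear (X + Y + Z) (X' + Y' + Z') (tens_rel R (tens_rel S T))"
      by (intro total_linear_assoc total_linear_tens)
    with * show ?thesis
      by (simp add: simps tens_rel_assoc)
  qed
  show "LUnit TLinRel X \<in> Hom TLinRel (TensObj TLinRel (UnitObj TLinRel) X) X"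
    "RUnit TLinRel X \<in> Hom TLinRel (TensObj TLinRel X (UnitObj TLinRel)) X"
    "is_iso TLinRel (LUnit TLinRel X)" "is_iso TLinRel (RUnit TLinRel X)" for X
    using TLinRel.is_iso_ident[of X] by (simp_all add: simps)
  show "Comp TLinRel (TensArr TLinRel (Ident TLinRel (UnitObj TLinRel)) f) (LUnit TLinRel Y) =
      Comp TLinRel (LUnit TLinRel X) f"
    "Comp TLinRel (TensArr TLinRel f (Ident TLinRel (UnitObj TLinRel))) (RUnit TLinRel Y) =
      Comp TLinRel (RUnit TLinRel X) f"
    if "f \<in> Hom TLinRel X Y" for f X Y
    using that by (auto simp: simps)
  show "Comp TLinRel (Assoc TLinRel (TensObj TLinRel W X) Y Z)
      (Assoc TLinRel W X (TensObj TLinRel Y Z)) =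
      Comp TLinRel (Comp TLinRel (TensArr TLinRel (Assoc TLinRel W X Y) (Ident TLinRel Z))
        (Assoc TLinRel W (TensObj TLinRel X Y) Z))
        (TensArr TLinRel (Ident TLinRel W) (Assoc TLinRel X Y Z))" for W X Y Z
    by (simp add: simps add.assoc)
  show "Comp TLinRel (Assoc TLinRel X (UnitObj TLinRel) Y)
      (TensArr TLinRel (Ident TLinRel X) (LUnit TLinRel Y)) =
      TensArr TLinRel (RUnit TLinRel X) (Ident TLinRel Y)" for X Y
    by (simp add: simps)
  show "Swap TLinRel X Y \<in> Hom TLinRel (TensObj TLinRel X Y) (TensObj TLinRel Y X)"
    "Comp TLinRel (Swap TLinRel X Y) (Swap TLinRel Y X) = Ident TLinRel (TensObj TLinRel X Y)"
        for X Y
    by (simp_all add: simps swap_swap_rel)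
  show "Comp TLinRel (TensArr TLinRel f g) (Swap TLinRel X' Y') =
      Comp TLinRel (Swap TLinRel X Y) (TensArr TLinRel g f)"
    if "f \<in> Hom TLinRel X X'" "g \<in> Hom TLinRel Y Y'" for f g X Y X' Y'
    using that by (auto simp: simps swap_natural_rel)
  show "Comp TLinRel (Comp TLinRel (Assoc TLinRel X Y Z) (Swap TLinRel X (TensObj TLinRel Y Z)))
      (Assoc TLinRel Y Z X) =
      Comp TLinRel (Comp TLinRel (TensArr TLinRel (Swap TLinRel X Y) (Ident TLinRel Z))
          (Assoc TLinRel Y X Z))
      (TensArr TLinRel (Ident TLinRel Y) (Swap TLinRel X Z))" for X Y Z
  proof -
    \<comment> \<open>This typing and the next fact absorb the identity associators on the two
      sides, leaving \<open>hexagon_rel\<close>.\<close>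
    have "total_linear (X + Y + Z) (Y + Z + X) (swap_rel X (Y + Z))"
      using total_linear_swap[of X "Y + Z"] by (simp add: add.assoc)
    moreover have "tens_rel (swap_rel X Y) (graph_on Z (\<lambda>x. x)) O graph_on (Y + X + Z) (\<lambda>x. x) =
        tens_rel (swap_rel X Y) (graph_on Z (\<lambda>x. x))"
      by (rule ident_rel(2)[OF total_linear_tens[OF total_linear_swap total_linear_ident]])
    ultimately show ?thesis
      by (simp add: simps) (simp add: hexagon_rel add.assoc)
  qed
qed

text \<open>Associators and their inverses are identities here, so of the five factors only the one
  containing the symmetry survives.\<close>

lemma middle_swap_TLinRel:
  "middle_swap TLinRel X Y = (X + X + (Y + Y), X + Y + (X + Y),
    tens_rel (graph_on X (\<lambda>x. x)) (tens_rel (swap_rel X Y) (graph_on Y (\<lambda>x. x))))"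
proof -
  have inv: "Inv TLinRel (Assoc TLinRel n m k) = Ident TLinRel (n + m + k)" for n m k
    unfolding TLinRel_Assoc by (rule TLinRel.Inv_ident) (simp add: TLinRel_simps)
  have "total_linear (X + X + (Y + Y)) (X + Y + (X + Y))
      (tens_rel (graph_on X (\<lambda>x. x)) (tens_rel (swap_rel X Y) (graph_on Y (\<lambda>x. x))))"
    using total_linear_tens[OF total_linear_ident[of X] total_linear_tens[OF total_linear_swap[of
        X Y] total_linear_ident[of Y]]]
    by (simp add: add.assoc)
  then show ?thesis
    unfolding middle_swap_def inv unfolding TLinRel_Assoc
    by (simp add: TLinRel_simps TLinRel_Swap tens_ident_rel)
      (simp add: ident_rel ident_ident_rel add.assoc)
qed

interpretation TLinRel: markov_category TLinRel
proof
  note simps = TLinRel_Hom TLinRel_simps TLinRel_Assoc TLinRel_Swap tens_rel_unit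
  show "Copy TLinRel X \<in> Hom TLinRel X (TensObj TLinRel X X)"
    "Del TLinRel X \<in> Hom TLinRel X (UnitObj TLinRel)"
    "Comp TLinRel (Copy TLinRel X) (Swap TLinRel X X) = Copy TLinRel X"
    "Copy TLinRel (TensObj TLinRel X Y) =
        Comp TLinRel (TensArr TLinRel (Copy TLinRel X) (Copy TLinRel Y))
        (middle_swap TLinRel X Y)" for X Y
    by (simp_all add: simps total_linear_copy total_linear_del copy_commutative_rel
        middle_swap_TLinRel copy_tens_rel)
  show "Comp TLinRel (Comp TLinRel (Copy TLinRel X)
      (TensArr TLinRel (Copy TLinRel X) (Ident TLinRel X))) (Assoc TLinRel X X X) =
      Comp TLinRel (Copy TLinRel X) (TensArr TLinRel (Ident TLinRel X) (Copy TLinRel X))" for X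
  proof -
    have "total_linear X (X + X + X) (graph_on X (\<lambda>x. x @\<^sub>v x) O
        tens_rel (graph_on X (\<lambda>x. x @\<^sub>v x)) (graph_on X (\<lambda>x. x)))"
      by (rule total_linear_comp[OF total_linear_copy total_linear_tens[OF total_linear_copy
          total_linear_ident]])
    then show ?thesis
      by (simp add: simps ident_rel) (simp add: copy_coassoc_rel add.assoc)
  qed
  show "Comp TLinRel (Comp TLinRel (Copy TLinRel X)
      (TensArr TLinRel (Del TLinRel X) (Ident TLinRel X))) (LUnit TLinRel X) = Ident TLinRel X"
    "Comp TLinRel (Comp TLinRel (Copy TLinRel X)
        (TensArr TLinRel (Ident TLinRel X) (Del TLinRel X))) (RUnit TLinRel X) =
        Ident TLinRel X" for X
    by (simp_all add: simps copy_counit_rel ident_ident_rel)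
  show "Del TLinRel (TensObj TLinRel X Y) =
      Comp TLinRel (TensArr TLinRel (Del TLinRel X) (Del TLinRel Y))
      (LUnit TLinRel (UnitObj TLinRel))" for X Y
    using total_linear_tens[OF total_linear_del[of X] total_linear_del[of Y]]
        by (simp add: simps del_tens_rel ident_rel)
  show "Comp TLinRel (Copy TLinRel (UnitObj TLinRel)) (LUnit TLinRel (UnitObj TLinRel)) =
      Ident TLinRel (UnitObj TLinRel)"
    "Del TLinRel (UnitObj TLinRel) = Ident TLinRel (UnitObj TLinRel)"
    by (simp_all add: simps del_unit_rel ident_ident_rel)
  show "Comp TLinRel f (Del TLinRel Y) = Del TLinRel X" if "f \<in> Hom TLinRel X Y" for f X Y
    using that by (auto simp: simps del_natural_rel)
qed


section \<open>Quotients of coordinate spaces\<close>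

lemma linear_map_onI:
  assumes "f \<in> extensional (carrier_vec n)"
    and "\<And>x. x \<in> carrier_vec n \<Longrightarrow> f x \<in> carrier_vec m"
    and "\<And>x y. x \<in> carrier_vec n \<Longrightarrow> y \<in> carrier_vec n \<Longrightarrow> f (x + y) = f x + f y"
    and "\<And>a x. x \<in> carrier_vec n \<Longrightarrow> f (a \<cdot>\<^sub>v x) = a \<cdot>\<^sub>v f x"
  shows "linear_map_on n m f"
  using assms by (simp add: linear_map_on_def PiE_def Pi_def)

lemma linear_map_on_restrictI:
  assumes "\<And>x. x \<in> carrier_vec n \<Longrightarrow> f x \<in> carrier_vec m"
    and "\<And>x y. x \<in> carrier_vec n \<Longrightarrow> y \<in> carrier_vec n \<Longrightarrow> f (x + y) = f x + f y"
    and "\<And>a x. x \<in> carrier_vec n \<Longrightarrow> f (a \<cdot>\<^sub>v x) = a \<cdot>\<^sub>v f x"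
  shows "linear_map_on n m (\<lambda>x\<in>carrier_vec n. f x)"
  by (rule linear_map_onI) (simp_all add: assms)

context
  fixes n m f assumes f: "linear_map_on n m f"
begin

lemma linear_carrier: "x \<in> carrier_vec n \<Longrightarrow> f x \<in> carrier_vec m"
  using f by (auto simp: linear_map_on_def)

lemma linear_add: "x \<in> carrier_vec n \<Longrightarrow> y \<in> carrier_vec n \<Longrightarrow> f (x + y) = f x + f y"
  using f by (simp add: linear_map_on_def)

lemma linear_smult: "x \<in> carrier_vec n \<Longrightarrow> f (a \<cdot>\<^sub>v x) = a \<cdot>\<^sub>v f x"
  using f by (simp add: linear_map_on_def)

lemma linear_zero: "f (0\<^sub>v n) = 0\<^sub>v m"
proof -
  have "f (0 \<cdot>\<^sub>v 0\<^sub>v n) = 0 \<cdot>\<^sub>v f (0\<^sub>v n)"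
    by (rule linear_smult) simp
  moreover have "0 \<cdot>\<^sub>v 0\<^sub>v n = (0\<^sub>v n :: real vec)"
    by (rule eq_vecI) simp_all
  moreover have "0 \<cdot>\<^sub>v f (0\<^sub>v n) = 0\<^sub>v m"
    using linear_carrier[of "0\<^sub>v n"] by (intro eq_vecI) auto
  ultimately show ?thesis by simp
qed

lemma linear_diff:
  assumes "x \<in> carrier_vec n" "y \<in> carrier_vec n"
  shows "f (x - y) = f x - f y"
proof -
  have "x - y = x + (-1) \<cdot>\<^sub>v y"
    using assms by (intro eq_vecI) simp_all
  then have "f (x - y) = f x + (-1) \<cdot>\<^sub>v f y"
    using assms by (simp add: linear_add linear_smult)
  also have "\<dots> = f x - f y"
    using assms linear_carrier[of x] linear_carrier[of y] by (intro eq_vecI) simp_all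
  finally show ?thesis .
qed

lemma linear_extensional: "f \<in> extensional (carrier_vec n)"
  using f by (simp add: linear_map_on_def PiE_def)

end

lemma vec_diff_eq_zero:
  fixes x y :: "real vec"
  assumes "x \<in> carrier_vec n" "y \<in> carrier_vec n"
  shows "x - y = 0\<^sub>v n \<longleftrightarrow> x = y"
proof
  assume "x - y = 0\<^sub>v n"
  then have "(x - y) $ i = 0" if "i < n" for i
    using that by simp
  then show "x = y"
    using assms by (intro eq_vecI) auto
qed (use assms in simp)

lemma linear_compose:
  assumes f: "linear_map_on n m f" and g: "linear_map_on m k g"
  shows "linear_map_on n k (compose (carrier_vec n) g f)"
  unfolding compose_def
  by (rule linear_map_on_restrictI)
    (simp_all add: linear_carrier[OF f] linear_carrier[OF g] linear_add[OF f] linear_add[OF g]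
      linear_smult[OF f] linear_smult[OF g])

lemma linear_ident: "linear_map_on n n (\<lambda>x\<in>carrier_vec n. x)"
  by (rule linear_map_on_restrictI) simp_all

lemma linear_map_eqI:
  assumes "linear_map_on n m f" "linear_map_on n m' g" "\<And>x. x \<in> carrier_vec n \<Longrightarrow> f x = g x"
  shows "f = g"
  using assms linear_extensional extensionalityI by metis

abbreviation onto :: "nat \<Rightarrow> nat \<Rightarrow> (real vec \<Rightarrow> real vec) \<Rightarrow> bool" where
  "onto n m f \<equiv> f ` carrier_vec n = carrier_vec m"

text \<open>Choose a coordinate \<open>i\<close> with \<open>w $ i\<close> nonzero, subtract the
  multiple of \<open>w\<close> that clears coordinate \<open>i\<close>, and delete that coordinate.
  A vector sent to zero equals the subtracted multiple, so the kernel lies in the line of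
  \<open>w\<close>.\<close>

lemma exists_projection_along_line:
  fixes w :: "real vec"
  assumes w: "w \<in> carrier_vec k" "w \<noteq> 0\<^sub>v k"
  obtains q where "k > 0" "linear_map_on k (k - 1) q" "onto k (k - 1) q"
    "\<And>u. u \<in> carrier_vec k \<Longrightarrow> q u = 0\<^sub>v (k - 1) \<Longrightarrow> \<exists>c. u = c \<cdot>\<^sub>v w"
proof -
  obtain i where i: "i < k" "w $ i \<noteq> 0"
    using w eq_vecI[of w "0\<^sub>v k"] by auto
  \<comment> \<open>\<open>s\<close> enumerates the coordinates other than \<open>i\<close> in
    increasing order.\<close>
  define s where "s j = (if j < i then j else Suc j)" for j
  have s: "s j < k" if "j < k - 1" for j
    using that i by (auto simp: s_def)
  define h where "h u = vec (k - 1) (\<lambda>j. u $ s j - u $ i / w $ i * w $ s j)" for u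
  define q where "q = (\<lambda>u\<in>carrier_vec k. h u)"
  have "linear_map_on k (k - 1) q"
    unfolding q_def
  proof (rule linear_map_on_restrictI)
    show "h u \<in> carrier_vec (k - 1)" for u
      by (simp add: h_def)
    show "h (u + v) = h u + h v" if "u \<in> carrier_vec k" "v \<in> carrier_vec k" for u v
      using that i by (intro eq_vecI) (simp_all add: h_def s field_simps)
    show "h (a \<cdot>\<^sub>v u) = a \<cdot>\<^sub>v h u" if "u \<in> carrier_vec k" for a u
      using that i by (intro eq_vecI) (simp_all add: h_def s field_simps)
  qed
  moreover have "onto k (k - 1) q"
  proof (intro equalityI subsetI)
    fix t :: "real vec" assume t: "t \<in> carrier_vec (k - 1)"
    \<comment> \<open>Inserting 0 at position \<open>i\<close> makes the subtracted multiple of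
      \<open>w\<close> vanish, so deleting that coordinate returns \<open>t\<close>.\<close>
    define u where "u = vec k (\<lambda>j. if j < i then t $ j else if j = i then 0 else t $ (j - 1))"
    have "h u = t"
      using t i by (intro eq_vecI) (auto simp: h_def u_def s_def)
    moreover have "u \<in> carrier_vec k"
      by (simp add: u_def)
    ultimately show "t \<in> q ` carrier_vec k"
      by (metis (no_types, lifting) q_def restrict_apply' image_eqI)
  qed (auto simp: q_def h_def)
  moreover have "u = (u $ i / w $ i) \<cdot>\<^sub>v w"
    if u: "u \<in> carrier_vec k" and 0: "q u = 0\<^sub>v (k - 1)" for u
  proof (rule eq_vecI)
    fix l assume "l < dim_vec ((u $ i / w $ i) \<cdot>\<^sub>v w)"
    then have l: "l < k" using w by simp
    show "u $ l = ((u $ i / w $ i) \<cdot>\<^sub>v w) $ l"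
    proof (cases "l = i")
      case True
      then show ?thesis using i w by simp
    next
      case False
      \<comment> \<open>The position of coordinate \<open>l\<close> after the deletion of
        \<open>i\<close>. Vanishing of \<open>q u\<close> there says that \<open>u $ l\<close> is
        \<open>u $ i / w $ i\<close> times \<open>w $ l\<close>.\<close>
      define j where "j = (if l < i then l else l - 1)"
      have "j < k - 1" "s j = l"
        using False l i by (auto simp: j_def s_def)
      moreover have "q u $ j = 0"
        using 0 \<open>j < k - 1\<close> by simp
      ultimately show ?thesis
        using u l w by (simp add: q_def h_def)
    qed
  qed (use u w in simp)
  ultimately show ?thesis
    using that i(1) by (metis gr_implies_not0 neq0_conv)
qed

text \<open>Among the surjections out of \<open>\<real>\<^sup>m\<close> with kernel inside \<open>K\<close>, one onto a space of least
  dimension has kernel \<open>K\<close>, since a vector of \<open>K\<close> outside the kernel could be divided out.\<close>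

lemma exists_quotient_map:
  fixes K :: "real vec set"
  assumes add: "\<And>x y. x \<in> K \<Longrightarrow> y \<in> K \<Longrightarrow> x + y \<in> K"
    and smult: "\<And>a x. x \<in> K \<Longrightarrow> a \<cdot>\<^sub>v x \<in> K"
    and zero: "0\<^sub>v m \<in> K" and carrier: "K \<subseteq> carrier_vec m"
  obtains k p where "linear_map_on m k p" "onto m k p"
    "\<And>y. y \<in> carrier_vec m \<Longrightarrow> p y = 0\<^sub>v k \<longleftrightarrow> y \<in> K"
proof -
  define P where "P k \<longleftrightarrow> (\<exists>p. linear_map_on m k p \<and> onto m k p \<and>
    (\<forall>y\<in>carrier_vec m. p y = 0\<^sub>v k \<longrightarrow> y \<in> K))" for k
  \<comment> \<open>The identity starts the descent: its kernel consists of zero alone, which lies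
    in \<open>K\<close>.\<close>
  have "P m"
    unfolding P_def using linear_ident[of m] zero by (intro exI[of _ "\<lambda>x\<in>carrier_vec m. x"]) auto
  define k where "k = (LEAST k. P k)"
  have "P k"
    unfolding k_def using \<open>P m\<close> by (rule LeastI)
  then obtain p where p: "linear_map_on m k p" "onto m k p"
    and ker: "\<And>y. y \<in> carrier_vec m \<Longrightarrow> p y = 0\<^sub>v k \<Longrightarrow> y \<in> K"
    unfolding P_def by blast
  have "p v = 0\<^sub>v k" if v: "v \<in> K" for v
  proof (rule ccontr)
    assume nz: "p v \<noteq> 0\<^sub>v k"
    have vm: "v \<in> carrier_vec m"
      using v carrier by blast
    obtain q where q: "k > 0" "linear_map_on k (k - 1) q" "onto k (k - 1) q"
      "\<And>u. u \<in> carrier_vec k \<Longrightarrow> q u = 0\<^sub>v (k - 1) \<Longrightarrow> \<exists>c. u = c \<cdot>\<^sub>v p v"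
      using exists_projection_along_line[OF linear_carrier[OF p(1) vm] nz] by blast
    let ?r = "compose (carrier_vec m) q p"
    have "y \<in> K" if y: "y \<in> carrier_vec m" and 0: "?r y = 0\<^sub>v (k - 1)" for y
    proof -
      obtain c where c: "p y = c \<cdot>\<^sub>v p v"
        using q(4)[of "p y"] linear_carrier[OF p(1) y] 0 y by (auto simp: compose_eq)
      \<comment> \<open>Dividing out \<open>p v\<close> enlarges the kernel only by multiples of
        \<open>v\<close>: a vector \<open>y\<close> of the new kernel differs from such a multiple
        by an element of the old kernel, so it stays in \<open>K\<close>. The target dimension has
        meanwhile dropped by one.\<close>
      have "p (y - c \<cdot>\<^sub>v v) = 0\<^sub>v k"
        using y vm linear_carrier[OF p(1) vm]
            by (simp add: linear_diff[OF p(1)] linear_smult[OF p(1)] c)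
      then have "y - c \<cdot>\<^sub>v v \<in> K"
        using y vm by (intro ker) simp_all
      then have "(y - c \<cdot>\<^sub>v v) + c \<cdot>\<^sub>v v \<in> K"
        using smult[OF v] by (rule add)
      moreover have "(y - c \<cdot>\<^sub>v v) + c \<cdot>\<^sub>v v = y"
        using y vm by (intro eq_vecI) simp_all
      ultimately show ?thesis by simp
    qed
    moreover have "?r ` carrier_vec m = q ` (p ` carrier_vec m)"
      by (auto simp: compose_eq image_image)
    ultimately have "P (k - 1)"
      unfolding P_def using linear_compose[OF p(1) q(2)] p(2) q(3) by auto
    then show False
      using not_less_Least[of "k - 1" P] q(1) by (simp add: k_def)
  qed
  with p ker show ?thesis
    using that by blast
qed

text \<open>Put \<open>u a = g y\<close> for an arbitrary chosen preimage \<open>y\<close> of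
  \<open>a\<close>. The choice itself need not be linear: by the kernel condition \<open>g y\<close>
  depends only on \<open>p y\<close>, so \<open>r (a + b)\<close> may be replaced by
  \<open>r a + r b\<close>, and likewise for scalars.\<close>

lemma exists_factorization:
  assumes p: "linear_map_on m k p" "onto m k p" and g: "linear_map_on m t g"
    and ker: "\<And>y. y \<in> carrier_vec m \<Longrightarrow> p y = 0\<^sub>v k \<Longrightarrow> g y = 0\<^sub>v t"
  obtains u where "linear_map_on k t u" "\<And>y. y \<in> carrier_vec m \<Longrightarrow> u (p y) = g y"
proof -
  define r where "r a = (SOME y. y \<in> carrier_vec m \<and> p y = a)" for a
  have r: "r a \<in> carrier_vec m" "p (r a) = a" if "a \<in> carrier_vec k" for a
  proof -
    have "a \<in> p ` carrier_vec m"
      using that by (simp add: p(2))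
    then have "\<exists>y. y \<in> carrier_vec m \<and> p y = a"
      by blast
    from someI_ex[OF this] show "r a \<in> carrier_vec m" "p (r a) = a"
      by (simp_all add: r_def)
  qed
  have eq: "g y = g y'" if "y \<in> carrier_vec m" "y' \<in> carrier_vec m" "p y = p y'" for y y'
  proof -
    have "p (y - y') = 0\<^sub>v k"
      using that by (simp add: linear_diff[OF p(1)] linear_carrier[OF p(1)])
    then have "g (y - y') = 0\<^sub>v t"
      using that by (intro ker) simp_all
    then show ?thesis
      using that by (simp add: linear_diff[OF g] vec_diff_eq_zero[OF linear_carrier[OF g]
          linear_carrier[OF g]])
  qed
  define u where "u = (\<lambda>a\<in>carrier_vec k. g (r a))"
  have "linear_map_on k t u"
    unfolding u_def
  proof (rule linear_map_on_restrictI)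
    show "g (r a) \<in> carrier_vec t" if "a \<in> carrier_vec k" for a
      using that by (simp add: linear_carrier[OF g] r)
    show "g (r (a + b)) = g (r a) + g (r b)" if "a \<in> carrier_vec k" "b \<in> carrier_vec k" for a b
    proof -
      have "g (r (a + b)) = g (r a + r b)"
        using that by (intro eq) (simp_all add: r linear_add[OF p(1)])
      then show ?thesis
        using that by (simp add: linear_add[OF g] r)
    qed
    show "g (r (c \<cdot>\<^sub>v a)) = c \<cdot>\<^sub>v g (r a)" if "a \<in> carrier_vec k" for c a
    proof -
      have "g (r (c \<cdot>\<^sub>v a)) = g (c \<cdot>\<^sub>v r a)"
        using that by (intro eq) (simp_all add: r linear_smult[OF p(1)])
      then show ?thesis
        using that by (simp add: linear_smult[OF g] r)
    qed
  qed
  moreover have "u (p y) = g y" if "y \<in> carrier_vec m" for y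
    unfolding u_def using that linear_carrier[OF p(1) that] eq[of "r (p y)" y] by (simp add: r)
  ultimately show ?thesis
    by (rule that)
qed

text \<open>The backward leg \<open>p\<close> divides out the vectors related to zero, and
  \<open>f x\<close> is \<open>p y\<close> for any \<open>y\<close> related to \<open>x\<close>.
  This is well defined because two vectors related to the same \<open>x\<close> differ by one
  related to zero.\<close>

lemma exists_cospan:
  assumes L: "total_linear n m L"
  obtains k f p where "linear_map_on n k f" "linear_map_on m k p" "onto m k p"
    "\<And>x y. x \<in> carrier_vec n \<Longrightarrow> y \<in> carrier_vec m \<Longrightarrow> f x = p y \<longleftrightarrow> (x, y) \<in> L"
proof -
  define K where "K = {y. (0\<^sub>v n, y) \<in> L}"
  have diff: "(x - x', y - y') \<in> L" if "(x, y) \<in> L" "(x', y') \<in> L" for x y x' y'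
  proof -
    have "(x + (-1) \<cdot>\<^sub>v x', y + (-1) \<cdot>\<^sub>v y') \<in> L"
      using that by (intro total_linear_add[OF L] total_linear_smult[OF L])
    moreover have "x + (-1) \<cdot>\<^sub>v x' = x - x'" "y + (-1) \<cdot>\<^sub>v y' = y - y'"
      using total_linear_carrier[OF L that(1)] total_linear_carrier[OF L that(2)]
          by (auto intro!: eq_vecI)
    ultimately show ?thesis by simp
  qed
  obtain k p where p: "linear_map_on m k p" "onto m k p"
    and ker: "\<And>y. y \<in> carrier_vec m \<Longrightarrow> p y = 0\<^sub>v k \<longleftrightarrow> y \<in> K"
  proof (rule exists_quotient_map[of K m])
    show "x + y \<in> K" if "x \<in> K" "y \<in> K" for x y
      using total_linear_add[OF L, of "0\<^sub>v n" x "0\<^sub>v n" y] that by (simp add: K_def)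
    show "a \<cdot>\<^sub>v x \<in> K" if "x \<in> K" for a x
    proof -
      have "a \<cdot>\<^sub>v 0\<^sub>v n = (0\<^sub>v n :: real vec)"
        by (rule eq_vecI) simp_all
      then show ?thesis
        using total_linear_smult[OF L, of "0\<^sub>v n" x a] that by (simp add: K_def)
    qed
    show "0\<^sub>v m \<in> K"
      using total_linear_zero[OF L] by (simp add: K_def)
    show "K \<subseteq> carrier_vec m"
      using total_linear_carrier[OF L] by (auto simp: K_def)
  qed (rule that; blast)
  define r where "r x = (SOME y. (x, y) \<in> L)" for x
  have r: "(x, r x) \<in> L" "r x \<in> carrier_vec m" if "x \<in> carrier_vec n" for x
  proof -
    show "(x, r x) \<in> L"
      unfolding r_def using total_linear_total[OF L that] by (rule someI_ex)
    then show "r x \<in> carrier_vec m"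
      using total_linear_carrier[OF L] by blast
  qed
  \<comment> \<open>This serves twice: it is the required description of \<open>L\<close>, and it
    makes \<open>p (r x)\<close> linear in \<open>x\<close> although the choice \<open>r\<close>
    need not be, since \<open>r x + r y\<close> is related to \<open>x + y\<close> and so has the
    same image as \<open>r (x + y)\<close>.\<close>
  have iff: "p (r x) = p y \<longleftrightarrow> (x, y) \<in> L" if x: "x \<in> carrier_vec n" and y: "y \<in> carrier_vec m"
      for x y
  proof -
    have "p (r x) = p y \<longleftrightarrow> p (r x - y) = 0\<^sub>v k"
      using r[OF x] y by (simp add: linear_diff[OF p(1)] vec_diff_eq_zero[OF linear_carrier[OF
          p(1)] linear_carrier[OF p(1)]])
    also have "\<dots> \<longleftrightarrow> (0\<^sub>v n, r x - y) \<in> L"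
      using r[OF x] y by (simp add: ker K_def)
    also have "\<dots> \<longleftrightarrow> (x, y) \<in> L"
    proof
      assume "(0\<^sub>v n, r x - y) \<in> L"
      from diff[OF r(1)[OF x] this] have "(x - 0\<^sub>v n, r x - (r x - y)) \<in> L" .
      moreover have "x - 0\<^sub>v n = x" "r x - (r x - y) = y"
        using x y r(2)[OF x] by (auto intro!: eq_vecI)
      ultimately show "(x, y) \<in> L" by simp
    next
      assume "(x, y) \<in> L"
      from diff[OF r(1)[OF x] this] show "(0\<^sub>v n, r x - y) \<in> L"
        using x by simp
    qed
    finally show ?thesis .
  qed
  define f where "f = (\<lambda>x\<in>carrier_vec n. p (r x))"
  have "linear_map_on n k f"
    unfolding f_def
  proof (rule linear_map_on_restrictI)
    show "p (r x) \<in> carrier_vec k" if "x \<in> carrier_vec n" for x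
      using that by (simp add: linear_carrier[OF p(1)] r)
    show "p (r (x + y)) = p (r x) + p (r y)" if "x \<in> carrier_vec n" "y \<in> carrier_vec n" for x y
    proof -
      have "p (r (x + y)) = p (r x + r y)"
        using that r by (subst iff) (auto intro: total_linear_add[OF L])
      then show ?thesis
        using that by (simp add: linear_add[OF p(1)] r)
    qed
    show "p (r (c \<cdot>\<^sub>v x)) = c \<cdot>\<^sub>v p (r x)" if "x \<in> carrier_vec n" for c x
    proof -
      have "p (r (c \<cdot>\<^sub>v x)) = p (c \<cdot>\<^sub>v r x)"
        using that r by (subst iff) (auto intro: total_linear_smult[OF L])
      then show ?thesis
        using that by (simp add: linear_smult[OF p(1)] r)
    qed
  qed
  moreover have "f x = p y \<longleftrightarrow> (x, y) \<in> L" if "x \<in> carrier_vec n" "y \<in> carrier_vec m" for x y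
    using that by (simp add: f_def iff)
  ultimately show ?thesis
    using that[OF _ p] by blast
qed


section \<open>Cospans and pushouts\<close>

lemma Vec_simps:
  "Obj Vec = UNIV"
  "(n, m, f) \<in> Arr Vec \<longleftrightarrow> linear_map_on n m f"
  "Dom Vec (n, m, f) = n"
  "Cod Vec (n, m, f) = m"
  "Ident Vec n = (n, n, \<lambda>x\<in>carrier_vec n. x)"
  "Comp Vec (n, m, f) (m', k, g) = (n, k, compose (carrier_vec n) g f)"
  by (simp_all add: Vec_def)

lemma Vec_Hom: "a \<in> Hom Vec n m \<longleftrightarrow> (\<exists>f. a = (n, m, f) \<and> linear_map_on n m f)"
  by (cases a) (auto simp: Hom_def Vec_simps)

lemma compose_eq_iff:
  assumes "linear_map_on n m f" "linear_map_on m k g" "linear_map_on n k h"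
  shows "compose (carrier_vec n) g f = h \<longleftrightarrow> (\<forall>x\<in>carrier_vec n. g (f x) = h x)"
proof
  assume "\<forall>x\<in>carrier_vec n. g (f x) = h x"
  then show "compose (carrier_vec n) g f = h"
    using assms by (intro linear_map_eqI[OF linear_compose]) (simp_all add: compose_eq)
qed (auto simp: compose_eq)

lemma cospans_iff:
  "((X', P, f), (Y', P', p)) \<in> cospans X Y \<longleftrightarrow>
    X' = X \<and> Y' = Y \<and> P' = P \<and> linear_map_on X P f \<and> linear_map_on Y P p \<and> onto Y P p"
  by (auto simp: cospans_def Vec_Hom Vec_simps surjective_arrow_def)

lemma cospansE:
  assumes "c \<in> cospans X Y"
  obtains P f p where "c = ((X, P, f), (Y, P, p))" "linear_map_on X P f" "linear_map_on Y P p"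
      "onto Y P p"
proof -
  obtain X' P f Y' P' p where "c = ((X', P, f), (Y', P', p))"
    by (metis prod.collapse)
  with assms that show ?thesis
    by (auto simp: cospans_iff)
qed

text \<open>The pullback of the two legs, seen as a subset of the product of their domains.\<close>

definition cospan_rel :: "lin_arrow \<times> lin_arrow \<Rightarrow> (real vec \<times> real vec) set" where
  "cospan_rel = (\<lambda>((X, P, f), (Y, Q, p)). {(x, y). x \<in> carrier_vec X \<and> y \<in> carrier_vec Y \<and> f x =
      p y})"

lemma cospan_rel_iff:
  "(x, y) \<in> cospan_rel ((X, P, f), (Y, Q, p)) \<longleftrightarrow> x \<in> carrier_vec X \<and> y \<in> carrier_vec Y \<and> f x = p y"
  by (simp add: cospan_rel_def)

lemma onto_image: "onto n m f \<Longrightarrow> y \<in> carrier_vec m \<Longrightarrow> \<exists>x\<in>carrier_vec n. f x = y"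
  by (metis imageE)

lemma total_linear_cospan_rel:
  assumes "c \<in> cospans X Y"
  shows "total_linear X Y (cospan_rel c)"
proof -
  obtain P f p where c: "c = ((X, P, f), (Y, P, p))"
    and f: "linear_map_on X P f" and p: "linear_map_on Y P p" "onto Y P p"
    using assms by (rule cospansE)
  show ?thesis
    unfolding c
  proof (rule total_linearI)
    show "\<exists>y. (x, y) \<in> cospan_rel ((X, P, f), (Y, P, p))" if "x \<in> carrier_vec X" for x
      using onto_image[OF p(2) linear_carrier[OF f that]] that by (auto simp: cospan_rel_iff)
  qed (simp_all add: cospan_rel_iff linear_add[OF f] linear_add[OF p(1)] linear_smult[OF f]
      linear_smult[OF p(1)])
qed

text \<open>An inclusion of relations induces a map of apexes. At \<open>x = 0\<close> it says that
  \<open>p'\<close> vanishes on the kernel of \<open>p\<close>, so \<open>p'\<close> factors through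
  \<open>p\<close>; the equation for \<open>f\<close> follows by lifting \<open>f x\<close> along
  \<open>p\<close>. It yields both the isomorphisms of cospans and the mediating maps out of
  pushouts.\<close>

lemma cospan_factorization:
  assumes f: "linear_map_on X P f" and p: "linear_map_on Y P p" "onto Y P p"
    and f': "linear_map_on X P' f'" and p': "linear_map_on Y P' p'"
    and sub: "\<And>x y. x \<in> carrier_vec X \<Longrightarrow> y \<in> carrier_vec Y \<Longrightarrow> f x = p y \<Longrightarrow> f' x = p' y"
  obtains h where "linear_map_on P P' h"
    "\<And>x. x \<in> carrier_vec X \<Longrightarrow> h (f x) = f' x" "\<And>y. y \<in> carrier_vec Y \<Longrightarrow> h (p y) = p' y"
proof -
  have "p' y = 0\<^sub>v P'" if "y \<in> carrier_vec Y" "p y = 0\<^sub>v P" for y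
    using sub[of "0\<^sub>v X" y] that linear_zero[OF f] linear_zero[OF f'] by simp
  then obtain h where h: "linear_map_on P P' h" "\<And>y. y \<in> carrier_vec Y \<Longrightarrow> h (p y) = p' y"
    using exists_factorization[OF p p'] by metis
  moreover have "h (f x) = f' x" if x: "x \<in> carrier_vec X" for x
  proof -
    obtain y where y: "y \<in> carrier_vec Y" "p y = f x"
      using onto_image[OF p(2) linear_carrier[OF f x]] by blast
    then show ?thesis
      using sub[OF x y(1)] h(2)[OF y(1)] by simp
  qed
  ultimately show ?thesis
    using that by blast
qed

text \<open>An isomorphism of apexes is injective, so it leaves the condition
  \<open>f x = p y\<close> unchanged. Conversely, factorization in both directions gives maps
  \<open>h\<close> and \<open>g\<close>, which are mutually inverse because they exchange
  \<open>p\<close> and \<open>p'\<close> and both are onto.\<close>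

lemma cospan_iso_iff:
  assumes c: "c \<in> cospans X Y" and c': "c' \<in> cospans X Y"
  shows "(c, c') \<in> cospan_iso X Y \<longleftrightarrow> cospan_rel c = cospan_rel c'"
proof -
  obtain P f p where c_eq: "c = ((X, P, f), (Y, P, p))"
    and f: "linear_map_on X P f" and p: "linear_map_on Y P p" "onto Y P p"
    using c by (rule cospansE)
  obtain P' f' p' where c'_eq: "c' = ((X, P', f'), (Y, P', p'))"
    and f': "linear_map_on X P' f'" and p': "linear_map_on Y P' p'" "onto Y P' p'"
    using c' by (rule cospansE)
  show ?thesis
  proof
    assume "(c, c') \<in> cospan_iso X Y"
    then obtain h g where h: "linear_map_on P P' h" "compose (carrier_vec X) h f = f'"
      "compose (carrier_vec Y) h p = p'" and g: "inverse_arrows Vec (P, P', h) g"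
      unfolding cospan_iso_def c_eq c'_eq is_iso_def by (auto simp: Vec_simps Vec_Hom)
    from g obtain g' where "compose (carrier_vec P) g' h = (\<lambda>x\<in>carrier_vec P. x)"
      by (cases g) (auto simp: inverse_arrows_def Vec_simps Vec_Hom)
    then have "g' (h a) = a" if "a \<in> carrier_vec P" for a
      using that by (metis compose_eq restrict_apply')
    then have "h a = h b \<longleftrightarrow> a = b" if "a \<in> carrier_vec P" "b \<in> carrier_vec P" for a b
      using that by metis
    then have "f' x = p' y \<longleftrightarrow> f x = p y" if "x \<in> carrier_vec X" "y \<in> carrier_vec Y" for x y
      using that linear_carrier[OF f] linear_carrier[OF p(1)] unfolding h(2,3)[symmetric]
      by (simp add: compose_eq)
    then show "cospan_rel c = cospan_rel c'"
      by (auto simp: c_eq c'_eq cospan_rel_iff)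
  next
    assume "cospan_rel c = cospan_rel c'"
    then have iff: "f x = p y \<longleftrightarrow> f' x = p' y" if "x \<in> carrier_vec X" "y \<in> carrier_vec Y" for x y
      using that cospan_rel_iff unfolding c_eq c'_eq by metis
    obtain h where h: "linear_map_on P P' h"
      "\<And>x. x \<in> carrier_vec X \<Longrightarrow> h (f x) = f' x" "\<And>y. y \<in> carrier_vec Y \<Longrightarrow> h (p y) = p' y"
      using cospan_factorization[OF f p f' p'(1)] iff by metis
    obtain g where g: "linear_map_on P' P g"
      "\<And>x. x \<in> carrier_vec X \<Longrightarrow> g (f' x) = f x" "\<And>y. y \<in> carrier_vec Y \<Longrightarrow> g (p' y) = p y"
      using cospan_factorization[OF f' p' f p(1)] iff by metis
    have "g (h a) = a" if "a \<in> carrier_vec P" for a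
      using onto_image[OF p(2) that] h(3) g(3) by metis
    moreover have "h (g a) = a" if "a \<in> carrier_vec P'" for a
      using onto_image[OF p'(2) that] h(3) g(3) by metis
    ultimately have "inverse_arrows Vec (P, P', h) (P', P, g)"
      using h(1) g(1) by (auto simp: inverse_arrows_def Vec_simps Vec_Hom compose_def intro!:
          restrict_ext)
    moreover have "compose (carrier_vec X) h f = f'" "compose (carrier_vec Y) h p = p'"
      using h by (simp_all add: compose_eq_iff[OF f h(1) f'] compose_eq_iff[OF p(1) h(1) p'(1)])
    ultimately show "(c, c') \<in> cospan_iso X Y"
      using c c' h(1) unfolding cospan_iso_def c_eq c'_eq is_iso_def
      by (auto simp: Vec_simps Vec_Hom intro!: exI)
  qed
qed

text \<open>The isomorphism class attached to \<open>L\<close>, described without choosing a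
  representative; see \<open>cospan_class_eq\<close>.\<close>

definition rel_cospans :: "nat \<Rightarrow> nat \<Rightarrow> (real vec \<times> real vec) set \<Rightarrow> (lin_arrow \<times> lin_arrow) set"
    where
  "rel_cospans X Y L = {c \<in> cospans X Y. cospan_rel c = L}"

lemma cospan_class_eq:
  assumes "c \<in> cospans X Y"
  shows "cospan_class X Y c = rel_cospans X Y (cospan_rel c)"
proof -
  have "c' \<in> cospans X Y" if "(c, c') \<in> cospan_iso X Y" for c'
    using that by (auto simp: cospan_iso_def)
  then have "(c, c') \<in> cospan_iso X Y \<longleftrightarrow> c' \<in> cospans X Y \<and> cospan_rel c' = cospan_rel c" for c'
    using cospan_iso_iff[OF assms, of c'] by metis
  then show ?thesis
    unfolding rel_cospans_def by blast
qed

text \<open>A representative is needed to see that the unions defining composition and tensor range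
  over a nonempty family, and to recover \<open>L\<close> from its class.\<close>

lemma rel_cospans_nonempty:
  assumes "total_linear X Y L"
  obtains P f p where "((X, P, f), (Y, P, p)) \<in> rel_cospans X Y L"
    "linear_map_on X P f" "linear_map_on Y P p" "onto Y P p"
proof -
  obtain P f p where fp: "linear_map_on X P f" "linear_map_on Y P p" "onto Y P p"
    "\<And>x y. x \<in> carrier_vec X \<Longrightarrow> y \<in> carrier_vec Y \<Longrightarrow> f x = p y \<longleftrightarrow> (x, y) \<in> L"
    using exists_cospan[OF assms] by blast
  have "cospan_rel ((X, P, f), (Y, P, p)) = L"
  proof (intro equalityI subrelI)
    fix x y assume "(x, y) \<in> L"
    then show "(x, y) \<in> cospan_rel ((X, P, f), (Y, P, p))"
      using fp(4)[of x y] total_linear_carrier[OF assms] by (simp add: cospan_rel_iff)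
  qed (auto simp: cospan_rel_iff fp(4))
  then have "((X, P, f), (Y, P, p)) \<in> rel_cospans X Y L"
    using fp by (simp add: rel_cospans_def cospans_iff)
  then show ?thesis
    using that fp by blast
qed

section \<open>Pushouts along a surjection, described by points\<close>

definition is_linear_pushout ::
  "nat \<Rightarrow> nat \<Rightarrow> nat \<Rightarrow> nat \<Rightarrow> (real vec \<Rightarrow> real vec) \<Rightarrow> (real vec \<Rightarrow> real vec)
    \<Rightarrow> (real vec \<Rightarrow> real vec) \<Rightarrow> (real vec \<Rightarrow> real vec) \<Rightarrow> bool" where
  "is_linear_pushout Y P Q R p g i j \<longleftrightarrow>
    linear_map_on P R i \<and> linear_map_on Q R j \<and> onto Q R j \<and>
    (\<forall>a\<in>carrier_vec P. \<forall>b\<in>carrier_vec Q. i a = j b \<longleftrightarrow> (\<exists>y\<in>carrier_vec Y. p y = a \<and> g y = b))"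

text \<open>Arrows of \<open>Vec\<close> carry their endpoints, so the universal property is moved
  to underlying functions: an arrow from \<open>R\<close> to \<open>T\<close> is
  \<open>(R, T, u)\<close> with \<open>u\<close> linear, and \<open>ex1\<close> transfers unique
  existence along this correspondence.\<close>

lemma is_pushout_Vec_iff:
  "is_pushout Vec (Y, P, p) (Y, Q, g) (P', R, i) (Q', R', j) \<longleftrightarrow>
    linear_map_on Y P p \<and> linear_map_on Y Q g \<and> P' = P \<and> Q' = Q \<and> R' = R \<and>
    linear_map_on P R i \<and> linear_map_on Q R j \<and> (\<forall>y\<in>carrier_vec Y. i (p y) = j (g y)) \<and>
    (\<forall>T i' j'. linear_map_on P T i' \<longrightarrow> linear_map_on Q T j' \<longrightarrow>
        (\<forall>y\<in>carrier_vec Y. i' (p y) = j' (g y)) \<longrightarrow>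
      (\<exists>!u. linear_map_on R T u \<and> (\<forall>a\<in>carrier_vec P. u (i a) = i' a) \<and>
          (\<forall>b\<in>carrier_vec Q. u (j b) = j' b)))"
proof -
  have ex1: "(\<exists>!u. u \<in> Hom Vec R T \<and> Comp Vec (P, R, i) u = (P, T, i') \<and> Comp Vec (Q, R, j) u =
      (Q, T, j')) \<longleftrightarrow>
      (\<exists>!u. linear_map_on R T u \<and> (\<forall>a\<in>carrier_vec P. u (i a) = i' a) \<and>
          (\<forall>b\<in>carrier_vec Q. u (j b) = j' b))"
    (is "(\<exists>!x. ?A x) \<longleftrightarrow> (\<exists>!u. ?B u)")
    if "linear_map_on P R i" "linear_map_on Q R j" "linear_map_on P T i'" "linear_map_on Q T j'"
        for T i' j'
  proof -
    have "?A x \<longleftrightarrow> (\<exists>u. x = (R, T, u) \<and> ?B u)" for x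
      using that by (auto simp: Vec_Hom Vec_simps compose_eq_iff)
    then show ?thesis by auto
  qed
  have comm: "compose (carrier_vec Y) i p = compose (carrier_vec Y) j g \<longleftrightarrow>
      (\<forall>y\<in>carrier_vec Y. i (p y) = j (g y))"
    if "linear_map_on Y P p" "linear_map_on Y Q g" "linear_map_on P T i" "linear_map_on Q T j"
        for T i j
    using compose_eq_iff[OF that(1,3) linear_compose[OF that(2,4)]] by (simp add: compose_eq)
  show ?thesis
  proof (cases "linear_map_on Y P p \<and> linear_map_on Y Q g \<and> P' = P \<and> Q' = Q \<and> R' = R \<and>
      linear_map_on P R i \<and> linear_map_on Q R j")
    case True
    then have "is_pushout Vec (Y, P, p) (Y, Q, g) (P', R, i) (Q', R', j) \<longleftrightarrow>
      (\<forall>y\<in>carrier_vec Y. i (p y) = j (g y)) \<and>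
      (\<forall>T. \<forall>x\<in>Hom Vec P T. \<forall>y\<in>Hom Vec Q T. Comp Vec (Y, P, p) x = Comp Vec (Y, Q, g) y \<longrightarrow>
        (\<exists>!u. u \<in> Hom Vec R T \<and> Comp Vec (P, R, i) u = x \<and> Comp Vec (Q, R, j) u = y))"
      using True by (simp add: is_pushout_def Vec_simps Vec_Hom[of "(P, R, i)"] Vec_Hom[of
          "(Q, R, j)"] comm[of R i j])
    also have "\<dots> \<longleftrightarrow> (\<forall>y\<in>carrier_vec Y. i (p y) = j (g y)) \<and>
      (\<forall>T i' j'. linear_map_on P T i' \<longrightarrow> linear_map_on Q T j' \<longrightarrow>
          (\<forall>y\<in>carrier_vec Y. i' (p y) = j' (g y)) \<longrightarrow>
        (\<exists>!u. u \<in> Hom Vec R T \<and> Comp Vec (P, R, i) u = (P, T, i') \<and> Comp Vec (Q, R, j) u =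
            (Q, T, j')))"
    proof -
      have "(\<forall>x\<in>Hom Vec P T. \<forall>y\<in>Hom Vec Q T. Comp Vec (Y, P, p) x = Comp Vec (Y, Q, g) y \<longrightarrow> Z x y) \<longleftrightarrow>
        (\<forall>i' j'. linear_map_on P T i' \<longrightarrow> linear_map_on Q T j' \<longrightarrow>
            (\<forall>y\<in>carrier_vec Y. i' (p y) = j' (g y)) \<longrightarrow>
          Z (P, T, i') (Q, T, j'))" for T Z
        using True comm by (fastforce simp: Vec_Hom Vec_simps)
      then show ?thesis by simp
    qed
    finally show ?thesis
      using True ex1 by simp
  qed (auto simp: is_pushout_def Vec_simps Vec_Hom)
qed

text \<open>The span itself gives the relation of all \<open>(p y, g y)\<close>, which is total
  because \<open>p\<close> is onto. A cospan representing it has exactly the required property,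
  including surjectivity of \<open>j\<close>.\<close>

lemma exists_linear_pushout:
  assumes p: "linear_map_on Y P p" "onto Y P p" and g: "linear_map_on Y Q g"
  obtains R i j where "is_linear_pushout Y P Q R p g i j"
proof -
  have "total_linear P Q {(p y, g y) | y. y \<in> carrier_vec Y}" (is "total_linear P Q ?M")
  proof (rule total_linearI)
    show "a \<in> carrier_vec P \<and> b \<in> carrier_vec Q" if "(a, b) \<in> ?M" for a b
      using that linear_carrier[OF p(1)] linear_carrier[OF g] by auto
    show "(a + a', b + b') \<in> ?M" if ab: "(a, b) \<in> ?M" "(a', b') \<in> ?M" for a b a' b'
    proof -
      obtain y y' where y: "y \<in> carrier_vec Y" "y' \<in> carrier_vec Y" "a = p y" "b = g y"
          "a' = p y'" "b' = g y'"
        using ab by auto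
      then have "a + a' = p (y + y')" "b + b' = g (y + y')"
        by (simp_all add: linear_add[OF p(1)] linear_add[OF g])
      moreover have "y + y' \<in> carrier_vec Y"
        using y by simp
      ultimately show ?thesis by blast
    qed
    show "(c \<cdot>\<^sub>v a, c \<cdot>\<^sub>v b) \<in> ?M" if ab: "(a, b) \<in> ?M" for c a b
    proof -
      obtain y where y: "y \<in> carrier_vec Y" "a = p y" "b = g y"
        using ab by auto
      then have "c \<cdot>\<^sub>v a = p (c \<cdot>\<^sub>v y)" "c \<cdot>\<^sub>v b = g (c \<cdot>\<^sub>v y)"
        by (simp_all add: linear_smult[OF p(1)] linear_smult[OF g])
      moreover have "c \<cdot>\<^sub>v y \<in> carrier_vec Y"
        using y by simp
      ultimately show ?thesis by blast
    qed
    show "\<exists>b. (a, b) \<in> ?M" if "a \<in> carrier_vec P" for a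
      using onto_image[OF p(2) that] by auto
  qed
  then obtain R i j where "linear_map_on P R i" "linear_map_on Q R j" "onto Q R j"
    "\<And>a b. a \<in> carrier_vec P \<Longrightarrow> b \<in> carrier_vec Q \<Longrightarrow> i a = j b \<longleftrightarrow> (a, b) \<in> ?M"
    using exists_cospan by blast
  then have "is_linear_pushout Y P Q R p g i j"
    by (auto simp: is_linear_pushout_def)
  then show ?thesis
    by (rule that)
qed

text \<open>A competing cocone agrees on all pairs \<open>(p y, g y)\<close>, that is, whenever
  \<open>i a = j b\<close>, so \<open>cospan_factorization\<close> gives the mediating map; it is
  unique because \<open>j\<close> is onto.\<close>

lemma linear_pushout_is_pushout:
  assumes p: "linear_map_on Y P p" "onto Y P p" and g: "linear_map_on Y Q g"
    and R: "is_linear_pushout Y P Q R p g i j"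
  shows "is_pushout Vec (Y, P, p) (Y, Q, g) (P, R, i) (Q, R, j)"
proof -
  have i: "linear_map_on P R i" and j: "linear_map_on Q R j" "onto Q R j"
    and iff: "\<And>a b. a \<in> carrier_vec P \<Longrightarrow> b \<in> carrier_vec Q \<Longrightarrow>
      i a = j b \<longleftrightarrow> (\<exists>y\<in>carrier_vec Y. p y = a \<and> g y = b)"
    using R by (auto simp: is_linear_pushout_def)
  have comm: "\<forall>y\<in>carrier_vec Y. i (p y) = j (g y)"
    using iff linear_carrier[OF p(1)] linear_carrier[OF g] by blast
  have univ: "\<exists>!u. linear_map_on R T u \<and> (\<forall>a\<in>carrier_vec P. u (i a) = i' a) \<and>
      (\<forall>b\<in>carrier_vec Q. u (j b) = j' b)"
    if i': "linear_map_on P T i'" and j': "linear_map_on Q T j'"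
      and comm': "\<forall>y\<in>carrier_vec Y. i' (p y) = j' (g y)" for T i' j'
  proof -
    have "i' a = j' b" if "a \<in> carrier_vec P" "b \<in> carrier_vec Q" "i a = j b" for a b
      using iff[OF that(1,2)] that(3) comm' by auto
    then obtain u where u: "linear_map_on R T u" "\<And>a. a \<in> carrier_vec P \<Longrightarrow> u (i a) = i' a"
      "\<And>b. b \<in> carrier_vec Q \<Longrightarrow> u (j b) = j' b"
      using cospan_factorization[OF i j i' j'] by metis
    moreover have "v = u" if v: "linear_map_on R T v" "\<forall>b\<in>carrier_vec Q. v (j b) = j' b" for v
    proof (rule linear_map_eqI[OF v(1) u(1)])
      show "v x = u x" if "x \<in> carrier_vec R" for x
        using onto_image[OF j(2) that] v(2) u(3) by metis
    qed
    ultimately show ?thesis by blast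
  qed
  show ?thesis
    unfolding is_pushout_Vec_iff using p(1) g i j(1) comm univ by blast
qed

text \<open>The given pushout is compared with a constructed one: \<open>u\<close> goes from the
  constructed apex to the given one by factorization, \<open>v\<close> goes back by the universal
  property, and \<open>u\<close> after \<open>v\<close> is the identity. Surjectivity of
  \<open>j\<close> and the description by points are carried across.\<close>

lemma pushout_is_linear_pushout:
  assumes p: "linear_map_on Y P p" "onto Y P p" and g: "linear_map_on Y Q g"
    and po: "is_pushout Vec (Y, P, p) (Y, Q, g) (P, R, i) (Q, R, j)"
  shows "is_linear_pushout Y P Q R p g i j"
proof -
  obtain R0 i0 j0 where R0: "is_linear_pushout Y P Q R0 p g i0 j0"
    using exists_linear_pushout[OF p g] by blast
  then have i0: "linear_map_on P R0 i0" and j0: "linear_map_on Q R0 j0" "onto Q R0 j0"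
    and iff: "\<And>a b. a \<in> carrier_vec P \<Longrightarrow> b \<in> carrier_vec Q \<Longrightarrow>
      i0 a = j0 b \<longleftrightarrow> (\<exists>y\<in>carrier_vec Y. p y = a \<and> g y = b)"
    by (auto simp: is_linear_pushout_def)
  have i: "linear_map_on P R i" and j: "linear_map_on Q R j"
    and comm: "\<forall>y\<in>carrier_vec Y. i (p y) = j (g y)"
    and univ: "\<And>T i' j'. linear_map_on P T i' \<Longrightarrow> linear_map_on Q T j' \<Longrightarrow>
        \<forall>y\<in>carrier_vec Y. i' (p y) = j' (g y) \<Longrightarrow>
      \<exists>!u. linear_map_on R T u \<and> (\<forall>a\<in>carrier_vec P. u (i a) = i' a) \<and>
          (\<forall>b\<in>carrier_vec Q. u (j b) = j' b)"
    using po unfolding is_pushout_Vec_iff by blast+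
  have comm0: "\<forall>y\<in>carrier_vec Y. i0 (p y) = j0 (g y)"
    using iff linear_carrier[OF p(1)] linear_carrier[OF g] by blast
  have "i a = j b" if "a \<in> carrier_vec P" "b \<in> carrier_vec Q" "i0 a = j0 b" for a b
    using iff[OF that(1,2)] that(3) comm by auto
  then obtain u where u: "linear_map_on R0 R u" "\<And>a. a \<in> carrier_vec P \<Longrightarrow> u (i0 a) = i a"
    "\<And>b. b \<in> carrier_vec Q \<Longrightarrow> u (j0 b) = j b"
    using cospan_factorization[OF i0 j0 i j] by metis
  obtain v where v: "linear_map_on R R0 v" "\<forall>a\<in>carrier_vec P. v (i a) = i0 a"
      "\<forall>b\<in>carrier_vec Q. v (j b) = j0 b"
    using univ[OF i0 j0(1) comm0] by blast
  have uv: "u (v r) = r" if r: "r \<in> carrier_vec R" for r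
  proof -
    \<comment> \<open>Both this composite and the identity mediate from the cocone
      \<open>(i, j)\<close> to itself, so uniqueness in the universal property equates them.\<close>
    have "linear_map_on R R (compose (carrier_vec R) u v)"
      by (rule linear_compose[OF v(1) u(1)])
    moreover have "\<forall>a\<in>carrier_vec P. compose (carrier_vec R) u v (i a) = i a"
      "\<forall>b\<in>carrier_vec Q. compose (carrier_vec R) u v (j b) = j b"
      using v u linear_carrier[OF i] linear_carrier[OF j] by (simp_all add: compose_eq)
    moreover have "\<forall>a\<in>carrier_vec P. (\<lambda>x\<in>carrier_vec R. x) (i a) = i a"
      "\<forall>b\<in>carrier_vec Q. (\<lambda>x\<in>carrier_vec R. x) (j b) = j b"
      using linear_carrier[OF i] linear_carrier[OF j] by simp_all
    ultimately have "compose (carrier_vec R) u v = (\<lambda>x\<in>carrier_vec R. x)"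
      using univ[OF i j comm] linear_ident[of R] by blast
    then show ?thesis
      using r by (metis compose_eq restrict_apply')
  qed
  have "onto Q R j"
  proof (intro equalityI subsetI)
    fix r :: "real vec" assume r: "r \<in> carrier_vec R"
    obtain b where b: "b \<in> carrier_vec Q" "j0 b = v r"
      using onto_image[OF j0(2) linear_carrier[OF v(1) r]] by blast
    then have "j b = r"
      using u(3)[OF b(1)] uv[OF r] by simp
    with b(1) show "r \<in> j ` carrier_vec Q"
      by blast
  qed (use linear_carrier[OF j] in auto)
  moreover have "i a = j b \<longleftrightarrow> (\<exists>y\<in>carrier_vec Y. p y = a \<and> g y = b)"
    if ab: "a \<in> carrier_vec P" "b \<in> carrier_vec Q" for a b
    \<comment> \<open>Applying \<open>v\<close> to \<open>i a = j b\<close> gives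
      \<open>i0 a = j0 b\<close>, hence a common \<open>y\<close>; the converse is commutativity of
      the given square.\<close>
    using iff[OF ab] v ab comm by metis
  ultimately show ?thesis
    using i j by (simp add: is_linear_pushout_def)
qed


section \<open>Copartial maps as total linear relations\<close>

definition copar_of_rel :: "rel_arrow \<Rightarrow> copar_arrow" where
  "copar_of_rel = (\<lambda>(X, Y, L). (X, Y, rel_cospans X Y L))"

lemma rel_cospans_cospan_rel: "c \<in> rel_cospans X Y L \<Longrightarrow> c \<in> cospans X Y \<and> cospan_rel c = L"
  by (simp add: rel_cospans_def)

lemma Union_constant: "A \<noteq> {} \<Longrightarrow> (\<And>S. S \<in> A \<Longrightarrow> S = B) \<Longrightarrow> \<Union>A = B"
  by auto

text \<open>The point description of the pushout turns \<open>i (f x) = j (q z)\<close> into the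
  existence of \<open>y\<close> with \<open>f x = p y\<close> and \<open>g y = q z\<close>, which is
  relational composition. All members of the union are therefore one and the same class.\<close>

lemma copar_comp_copar_of_rel:
  assumes R: "total_linear X Y R" and S: "total_linear Y Z S"
  shows "copar_comp (copar_of_rel (X, Y, R)) (copar_of_rel (Y, Z, S)) = copar_of_rel (X, Z, R O S)"
proof -
  let ?A = "{cospan_class X Z (Comp Vec f i, Comp Vec q j) | f p g q i j.
    (f, p) \<in> rel_cospans X Y R \<and> (g, q) \<in> rel_cospans Y Z S \<and> is_pushout Vec p g i j}"
  have "\<Union>?A = rel_cospans X Z (R O S)"
  proof (rule Union_constant)
    obtain P f p where fp: "((X, P, f), (Y, P, p)) \<in> rel_cospans X Y R"
      "linear_map_on X P f" "linear_map_on Y P p" "onto Y P p"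
      using rel_cospans_nonempty[OF R] by blast
    obtain Q g q where gq: "((Y, Q, g), (Z, Q, q)) \<in> rel_cospans Y Z S"
      "linear_map_on Y Q g" "linear_map_on Z Q q" "onto Z Q q"
      using rel_cospans_nonempty[OF S] by blast
    obtain T i j where "is_linear_pushout Y P Q T p g i j"
      using exists_linear_pushout[OF fp(3,4) gq(2)] by blast
    then have "is_pushout Vec (Y, P, p) (Y, Q, g) (P, T, i) (Q, T, j)"
      by (rule linear_pushout_is_pushout[OF fp(3,4) gq(2)])
    with fp(1) gq(1) show "?A \<noteq> {}"
      by blast
  next
    fix V assume "V \<in> ?A"
    then obtain f p g q i j where V: "V = cospan_class X Z (Comp Vec f i, Comp Vec q j)"
      and fp: "(f, p) \<in> rel_cospans X Y R" and gq: "(g, q) \<in> rel_cospans Y Z S"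
      and po: "is_pushout Vec p g i j"
      by blast
    have "(f, p) \<in> cospans X Y" and fp_rel: "cospan_rel (f, p) = R"
      using rel_cospans_cospan_rel[OF fp] by simp_all
    then obtain P f' p' where f: "f = (X, P, f')" "linear_map_on X P f'"
      and p: "p = (Y, P, p')" "linear_map_on Y P p'" "onto Y P p'"
      by (auto elim: cospansE)
    have "(g, q) \<in> cospans Y Z" and gq_rel: "cospan_rel (g, q) = S"
      using rel_cospans_cospan_rel[OF gq] by simp_all
    then obtain Q g' q' where g: "g = (Y, Q, g')" "linear_map_on Y Q g'"
      and q: "q = (Z, Q, q')" "linear_map_on Z Q q'" "onto Z Q q'"
      by (auto elim: cospansE)
    \<comment> \<open>The pushout legs are arbitrary arrows; the typing contained in
      \<open>is_pushout\<close> forces their endpoints.\<close>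
    obtain P1 T i' Q1 T1 j' where "i = (P1, T, i')" "j = (Q1, T1, j')"
      by (metis prod.collapse)
    with po have i: "i = (P, T, i')" and j: "j = (Q, T, j')"
      by (simp_all add: p(1) g(1) is_pushout_Vec_iff)
    have "is_linear_pushout Y P Q T p' g' i' j'"
      using po unfolding p(1) g(1) i j by (rule pushout_is_linear_pushout[OF p(2,3) g(2)])
    then have i': "linear_map_on P T i'" and j': "linear_map_on Q T j'" "onto Q T j'"
      and iff: "\<And>a b. a \<in> carrier_vec P \<Longrightarrow> b \<in> carrier_vec Q \<Longrightarrow>
        i' a = j' b \<longleftrightarrow> (\<exists>y\<in>carrier_vec Y. p' y = a \<and> g' y = b)"
      by (auto simp: is_linear_pushout_def)
    have "compose (carrier_vec Z) j' q' ` carrier_vec Z = j' ` (q' ` carrier_vec Z)"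
      by (auto simp: compose_eq image_image)
    then have cospan: "(Comp Vec f i, Comp Vec q j) \<in> cospans X Z"
      using linear_compose[OF f(2) i'] linear_compose[OF q(2) j'(1)] q(3) j'(2)
      by (simp add: f(1) q(1) i j Vec_simps cospans_iff)
    have "(x, z) \<in> cospan_rel (Comp Vec f i, Comp Vec q j) \<longleftrightarrow> (x, z) \<in> R O S" for x z
    proof (cases "x \<in> carrier_vec X \<and> z \<in> carrier_vec Z")
      case True
      then have "(x, z) \<in> cospan_rel (Comp Vec f i, Comp Vec q j) \<longleftrightarrow> i' (f' x) = j' (q' z)"
        by (simp add: f(1) q(1) i j Vec_simps cospan_rel_iff compose_eq)
      also have "\<dots> \<longleftrightarrow> (\<exists>y\<in>carrier_vec Y. p' y = f' x \<and> g' y = q' z)"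
        using True by (intro iff linear_carrier[OF f(2)] linear_carrier[OF q(2)]) simp_all
      also have "\<dots> \<longleftrightarrow> (\<exists>y. (x, y) \<in> cospan_rel (f, p) \<and> (y, z) \<in> cospan_rel (g, q))"
        using True by (auto simp: f(1) p(1) g(1) q(1) cospan_rel_iff)
      finally show ?thesis
        by (auto simp: fp_rel gq_rel)
    next
      case False
      then have "(x, z) \<notin> cospan_rel (Comp Vec f i, Comp Vec q j)"
        by (auto simp: f(1) q(1) i j Vec_simps cospan_rel_iff)
      moreover have "(x, z) \<notin> R O S"
        using False total_linear_carrier[OF R] total_linear_carrier[OF S] by auto
      ultimately show ?thesis by simp
    qed
    then have "cospan_rel (Comp Vec f i, Comp Vec q j) = R O S"
      by (metis (no_types, lifting) subrelI subset_antisym)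
    then show "V = rel_cospans X Z (R O S)"
      unfolding V cospan_class_eq[OF cospan] by simp
  qed
  then show ?thesis
    by (simp add: copar_comp_def copar_of_rel_def)
qed

section \<open>Block sums of linear maps and the tensor of copartial maps\<close>

lemma linear_sum:
  assumes f: "linear_map_on n m f" and g: "linear_map_on n' m' g"
  shows "linear_map_on (n + n') (m + m')
      (\<lambda>x\<in>carrier_vec (n + n'). f (vec_first x n) @\<^sub>v g (vec_last x n'))"
proof (rule linear_map_on_restrictI)
  show "f (vec_first x n) @\<^sub>v g (vec_last x n') \<in> carrier_vec (m + m')" for x
    by (intro append_carrier_vec linear_carrier[OF f] linear_carrier[OF g]) simp_all
  show "f (vec_first (x + y) n) @\<^sub>v g (vec_last (x + y) n') =
      (f (vec_first x n) @\<^sub>v g (vec_last x n')) + (f (vec_first y n) @\<^sub>v g (vec_last y n'))"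
    if "x \<in> carrier_vec (n + n')" "y \<in> carrier_vec (n + n')" for x y
    using that append_vec_add[of "f (vec_first x n)" m "f (vec_first y n)" "g (vec_last x n')"
        m' "g (vec_last y n')"]
    by (simp add: vec_first_add vec_last_add linear_add[OF f] linear_add[OF g] linear_carrier[OF
        f] linear_carrier[OF g])
  show "f (vec_first (a \<cdot>\<^sub>v x) n) @\<^sub>v g (vec_last (a \<cdot>\<^sub>v x) n') =
      a \<cdot>\<^sub>v (f (vec_first x n) @\<^sub>v g (vec_last x n'))" if "x \<in> carrier_vec (n + n')" for a x
    using that by (simp add: vec_first_smult vec_last_smult linear_smult[OF f] linear_smult[OF g]
        smult_append_vec)
qed

lemma onto_sum:
  assumes f: "linear_map_on n m f" "onto n m f" and g: "linear_map_on n' m' g" "onto n' m' g"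
  shows "onto (n + n') (m + m') (\<lambda>x\<in>carrier_vec (n + n'). f (vec_first x n) @\<^sub>v g (vec_last x n'))"
    (is "onto _ _ ?h")
proof (intro equalityI subsetI)
  fix y :: "real vec" assume "y \<in> carrier_vec (m + m')"
  then obtain y1 y2 where y: "y = y1 @\<^sub>v y2" "y1 \<in> carrier_vec m" "y2 \<in> carrier_vec m'"
    by (rule carrier_vec_appendE)
  obtain x1 where x1: "x1 \<in> carrier_vec n" "f x1 = y1"
    using onto_image[OF f(2) y(2)] by blast
  obtain x2 where x2: "x2 \<in> carrier_vec n'" "g x2 = y2"
    using onto_image[OF g(2) y(3)] by blast
  have "?h (x1 @\<^sub>v x2) = y" "x1 @\<^sub>v x2 \<in> carrier_vec (n + n')"
    using x1 x2 y by simp_all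
  then show "y \<in> ?h ` carrier_vec (n + n')"
    by (rule image_eqI[OF sym])
next
  fix y assume "y \<in> ?h ` carrier_vec (n + n')"
  then obtain x where "x \<in> carrier_vec (n + n')" "y = ?h x"
    by (rule imageE)
  then show "y \<in> carrier_vec (m + m')"
    using linear_carrier[OF linear_sum[OF f(1) g(1)], of x] by metis
qed

text \<open>Equality of the two concatenations in the apex splits into equality of the blocks, so
  the relation of a block sum is the block sum of the relations, whichever representatives are
  used.\<close>

lemma copar_tens_copar_of_rel:
  assumes R: "total_linear X Y R" and S: "total_linear X' Y' S"
  shows "copar_tens (copar_of_rel (X, Y, R)) (copar_of_rel (X', Y', S)) =
    copar_of_rel (X + X', Y + Y', tens_rel R S)"
proof -
  let ?A = "{cospan_class (X + X') (Y + Y') (vec_sum f1 f2, vec_sum p1 p2) | f1 p1 f2 p2.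
    (f1, p1) \<in> rel_cospans X Y R \<and> (f2, p2) \<in> rel_cospans X' Y' S}"
  have "\<Union>?A = rel_cospans (X + X') (Y + Y') (tens_rel R S)"
  proof (rule Union_constant)
    obtain c d where "c \<in> rel_cospans X Y R" "d \<in> rel_cospans X' Y' S"
      using rel_cospans_nonempty[OF R] rel_cospans_nonempty[OF S] by metis
    then show "?A \<noteq> {}"
      by (cases c; cases d) blast
  next
    fix V assume "V \<in> ?A"
    then obtain f1 p1 f2 p2 where V: "V =
        cospan_class (X + X') (Y + Y') (vec_sum f1 f2, vec_sum p1 p2)"
      and fp1: "(f1, p1) \<in> rel_cospans X Y R" and fp2: "(f2, p2) \<in> rel_cospans X' Y' S"
      by blast
    have "(f1, p1) \<in> cospans X Y" and rel1: "cospan_rel (f1, p1) = R"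
      using rel_cospans_cospan_rel[OF fp1] by simp_all
    then obtain P f p where f: "f1 = (X, P, f)" "linear_map_on X P f"
      and p: "p1 = (Y, P, p)" "linear_map_on Y P p" "onto Y P p"
      by (auto elim: cospansE)
    have "(f2, p2) \<in> cospans X' Y'" and rel2: "cospan_rel (f2, p2) = S"
      using rel_cospans_cospan_rel[OF fp2] by simp_all
    then obtain P' f' p' where f': "f2 = (X', P', f')" "linear_map_on X' P' f'"
      and p': "p2 = (Y', P', p')" "linear_map_on Y' P' p'" "onto Y' P' p'"
      by (auto elim: cospansE)
    have cospan: "(vec_sum f1 f2, vec_sum p1 p2) \<in> cospans (X + X') (Y + Y')"
      using linear_sum[OF f(2) f'(2)] linear_sum[OF p(2) p'(2)] onto_sum[OF p(2,3) p'(2,3)]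
      by (simp add: vec_sum_def f(1) f'(1) p(1) p'(1) cospans_iff)
    have iff: "(x1 @\<^sub>v x2, y1 @\<^sub>v y2) \<in> cospan_rel (vec_sum f1 f2, vec_sum p1 p2) \<longleftrightarrow> (x1, y1) \<in> R \<and>
        (x2, y2) \<in> S"
      if x: "x1 \<in> carrier_vec X" "x2 \<in> carrier_vec X'" "y1 \<in> carrier_vec Y" "y2 \<in> carrier_vec Y'"
          for x1 x2 y1 y2
      using x append_vec_eq[OF linear_carrier[OF f(2) x(1)] linear_carrier[OF p(2) x(3)], of "f'
          x2" "p' y2"]
      unfolding rel1[symmetric] rel2[symmetric]
      by (simp add: vec_sum_def f(1) f'(1) p(1) p'(1) cospan_rel_iff)
    have "cospan_rel (vec_sum f1 f2, vec_sum p1 p2) = tens_rel R S"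
    proof (intro equalityI subrelI)
      fix x y assume xy: "(x, y) \<in> cospan_rel (vec_sum f1 f2, vec_sum p1 p2)"
      then have "x \<in> carrier_vec (X + X')" "y \<in> carrier_vec (Y + Y')"
        using total_linear_carrier[OF total_linear_cospan_rel[OF cospan]] by blast+
      then obtain x1 x2 y1 y2 where "x = x1 @\<^sub>v x2" "x1 \<in> carrier_vec X" "x2 \<in> carrier_vec X'"
        "y = y1 @\<^sub>v y2" "y1 \<in> carrier_vec Y" "y2 \<in> carrier_vec Y'"
        by (elim carrier_vec_appendE)
      with xy iff show "(x, y) \<in> tens_rel R S"
        by (simp add: tens_relI)
    next
      fix x y assume "(x, y) \<in> tens_rel R S"
      then obtain x1 x2 y1 y2 where "x = x1 @\<^sub>v x2" "y = y1 @\<^sub>v y2" "(x1, y1) \<in> R" "(x2, y2) \<in> S"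
        by (rule tens_relE)
      with iff total_linear_carrier[OF R] total_linear_carrier[OF S]
      show "(x, y) \<in> cospan_rel (vec_sum f1 f2, vec_sum p1 p2)"
        by metis
    qed
    then show "V = rel_cospans (X + X') (Y + Y') (tens_rel R S)"
      unfolding V cospan_class_eq[OF cospan] by simp
  qed
  then show ?thesis
    by (simp add: copar_tens_def copar_of_rel_def)
qed

text \<open>With the identity as backward leg, the condition \<open>f x = p y\<close> reads
  \<open>y = f x\<close>.\<close>

lemma copar_of_graph:
  assumes f: "linear_map_on n m (\<lambda>x\<in>carrier_vec n. f x)"
  shows "copar_of (n, m, \<lambda>x\<in>carrier_vec n. f x) = copar_of_rel (n, m, graph_on n f)"
proof -
  let ?c = "((n, m, \<lambda>x\<in>carrier_vec n. f x), (m, m, \<lambda>x\<in>carrier_vec m. x))"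
  have "?c \<in> cospans n m"
    using f linear_ident[of m] by (auto simp: cospans_iff)
  moreover have "cospan_rel ?c = graph_on n f"
  proof (intro equalityI subrelI)
    fix x y assume "(x, y) \<in> graph_on n f"
    then show "(x, y) \<in> cospan_rel ?c"
      using linear_carrier[OF f, of x] by (simp add: cospan_rel_iff graph_on_iff)
  qed (auto simp: cospan_rel_iff graph_on_iff)
  ultimately show ?thesis
    by (simp add: copar_of_def copar_of_rel_def Vec_simps cospan_class_eq)
qed

lemma copar_of_ident: "copar_of (Ident Vec n) = copar_of_rel (n, n, graph_on n (\<lambda>x. x))"
  unfolding Vec_simps by (rule copar_of_graph[OF linear_ident])

text \<open>Linearity of the swap, diagonal and zero maps is read back from the linearity of their
  graphs, already established on the side of relations.\<close>

lemma linear_graph: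
  assumes "total_linear n m (graph_on n f)"
  shows "linear_map_on n m (\<lambda>x\<in>carrier_vec n. f x)"
proof (rule linear_map_on_restrictI)
  show "f x \<in> carrier_vec m" if "x \<in> carrier_vec n" for x
    using total_linear_carrier[OF assms, of x "f x"] that by (simp add: graph_on_iff)
  show "f (x + y) = f x + f y" if "x \<in> carrier_vec n" "y \<in> carrier_vec n" for x y
    using total_linear_add[OF assms, of x "f x" y "f y"] that by (simp add: graph_on_iff)
  show "f (a \<cdot>\<^sub>v x) = a \<cdot>\<^sub>v f x" if "x \<in> carrier_vec n" for a x
    using total_linear_smult[OF assms, of x "f x" a] that by (simp add: graph_on_iff)
qed

lemma Arr_CoparVec: "Arr CoparVec = {(X, Y, rel_cospans X Y L) | X Y L. total_linear X Y L}"
proof -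
  have "c \<in> cospans X Y // cospan_iso X Y \<longleftrightarrow> (\<exists>L. c = rel_cospans X Y L \<and> total_linear X Y L)"
      for X Y c
  proof
    assume "c \<in> cospans X Y // cospan_iso X Y"
    then obtain d where "d \<in> cospans X Y" "c = cospan_class X Y d"
      by (auto simp: quotient_def)
    then show "\<exists>L. c = rel_cospans X Y L \<and> total_linear X Y L"
      using cospan_class_eq total_linear_cospan_rel by blast
  next
    assume "\<exists>L. c = rel_cospans X Y L \<and> total_linear X Y L"
    then obtain L where L: "c = rel_cospans X Y L" "total_linear X Y L" by blast
    then obtain d where "d \<in> rel_cospans X Y L"
      using rel_cospans_nonempty by metis
    then have "d \<in> cospans X Y" "c = cospan_class X Y d"
      using rel_cospans_cospan_rel[of d X Y L] L(1) cospan_class_eq[of d X Y] by simp_all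
    then show "c \<in> cospans X Y // cospan_iso X Y"
      by (simp add: quotientI)
  qed
  then show ?thesis
    by (auto simp: CoparVec_def)
qed

text \<open>Injectivity holds because \<open>L\<close> is recovered as the relation of any member of
  its class, and the class has a member. Surjectivity is \<open>Arr_CoparVec\<close>.\<close>

lemma bij_copar_of_rel: "bij_betw copar_of_rel (Arr TLinRel) (Arr CoparVec)"
proof (rule bij_betwI')
  fix a b assume ab: "a \<in> Arr TLinRel" "b \<in> Arr TLinRel"
  obtain X Y L X' Y' L' where eqs: "a = (X, Y, L)" "b = (X', Y', L')"
    by (metis prod.collapse)
  have "L = L'" if "rel_cospans X Y L = rel_cospans X Y L'"
  proof -
    have "total_linear X Y L" using ab eqs by (simp add: TLinRel_simps)
    then obtain c where "c \<in> rel_cospans X Y L"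
      using rel_cospans_nonempty by metis
    with that show ?thesis
      using rel_cospans_cospan_rel by metis
  qed
  then show "copar_of_rel a = copar_of_rel b \<longleftrightarrow> a = b"
    by (auto simp: eqs copar_of_rel_def)
next
  fix a assume "a \<in> Arr TLinRel"
  then show "copar_of_rel a \<in> Arr CoparVec"
    by (cases a) (auto simp: Arr_CoparVec copar_of_rel_def TLinRel_simps)
next
  fix c assume "c \<in> Arr CoparVec"
  then obtain X Y L where "c = (X, Y, rel_cospans X Y L)" "total_linear X Y L"
    by (auto simp: Arr_CoparVec)
  then show "\<exists>a\<in>Arr TLinRel. c = copar_of_rel a"
    by (intro bexI[of _ "(X, Y, L)"]) (simp_all add: copar_of_rel_def TLinRel_simps)
qed

interpretation copar: strict_markov_iso TLinRel CoparVec copar_of_rel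
proof
  show "Obj CoparVec = Obj TLinRel" "TensObj CoparVec = TensObj TLinRel"
      "UnitObj CoparVec = UnitObj TLinRel"
    by (simp_all add: CoparVec_def TLinRel_simps)
  show "bij_betw copar_of_rel (Arr TLinRel) (Arr CoparVec)"
    by (rule bij_copar_of_rel)
  then show "copar_of_rel f \<in> Arr CoparVec" if "f \<in> Arr TLinRel" for f
    using that by (rule bij_betwE[rule_format])
  show "Dom CoparVec (copar_of_rel f) = Dom TLinRel f"
      "Cod CoparVec (copar_of_rel f) = Cod TLinRel f" for f
    by (cases f; simp add: CoparVec_def copar_of_rel_def TLinRel_simps)+
  show "Ident CoparVec X = copar_of_rel (Ident TLinRel X)"
      "LUnit CoparVec X = copar_of_rel (LUnit TLinRel X)"
    "RUnit CoparVec X = copar_of_rel (RUnit TLinRel X)"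
    "Assoc CoparVec X Y Z = copar_of_rel (Assoc TLinRel X Y Z)" for X Y Z
    by (simp_all add: CoparVec_def TLinRel_simps TLinRel_Assoc copar_of_ident)
  show "Comp CoparVec (copar_of_rel f) (copar_of_rel g) = copar_of_rel (Comp TLinRel f g)"
    if "f \<in> Arr TLinRel" "g \<in> Arr TLinRel" "Cod TLinRel f = Dom TLinRel g" for f g
    using that by (cases f; cases g) (simp add: CoparVec_def TLinRel_simps copar_comp_copar_of_rel)
  show "TensArr CoparVec (copar_of_rel f) (copar_of_rel g) = copar_of_rel (TensArr TLinRel f g)"
    if "f \<in> Arr TLinRel" "g \<in> Arr TLinRel" for f g
    using that by (cases f; cases g) (simp add: CoparVec_def TLinRel_simps copar_tens_copar_of_rel)
  show "Swap CoparVec X Y = copar_of_rel (Swap TLinRel X Y)" for X Y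
    using copar_of_graph[OF linear_graph[OF total_linear_swap[unfolded swap_rel_def]]]
    by (simp add: CoparVec_def TLinRel_Swap vec_swap_def swap_rel_def)
  show "Copy CoparVec X = copar_of_rel (Copy TLinRel X)" for X
    using copar_of_graph[OF linear_graph[OF total_linear_copy]]
    by (simp add: CoparVec_def TLinRel_simps vec_diag_def)
  show "Del CoparVec X = copar_of_rel (Del TLinRel X)" for X
    using copar_of_graph[OF linear_graph[OF total_linear_del]]
    by (simp add: CoparVec_def TLinRel_simps vec_bang_def)
qed

theorem proposition4p5:
  shows "markov_category TLinRel \<and> markov_category CoparVec \<and> markov_equivalent TLinRel CoparVec"
  using TLinRel.markov_category_axioms copar.markov_category_D copar.markov_equivalent_D by blast

end
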